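(* Consider the problem $\min_{x\in\mathbb{R}^N} g(x)+F(x)$, $F=\frac1n\sum_{i=1}^n f_i$, under the Problem Properties assumption, and the SAGA algorithm (see context). Let $L_{\max}=\max_iL_i$, $\bar L=\frac1n\sum_{i=1}^nL_i$, $p_{\min}=\min_ip_i$, $C_U=2+2\sqrt{1-\frac{\mu}{L_{\max}}}$ and $C_L=2+2\sqrt{1-\frac{\mu}{\bar L}}$. The maximal step-size $\lambda_{\max}$ (in the sense defined in the context) and the recommended step-size $\lambda^\star$ for SAGA are as follows. If $p_i=\frac1n$ for all $i$: $$\lambda_{\max}=\frac{2}{C_UL_{\max}},\qquad \lambda^\star=\frac{2}{C_UL_{\max}+n\mu+\sqrt{(C_UL_{\max})^2+(n\mu)^2}}.$$ If $p_i\propto L_i$ (i.e. $p_i=L_i/\sum_jL_j$): $$\lambda_{\max}=\frac{2}{C_L\bar L},\qquad \lambda^\star=\frac{2}{C_L\bar L+p_{\min}^{-1}\mu+\sqrt{(C_L\bar L)^2+(p_{\min}^{-1}\mu)^2}}.$$ In either case, when the step-size $\lambda=\lambda^\star$ is used, the iterates satisfy $\mathbb{E}\|x^k-x^\star\|^2\in\mathcal{O}\big((1-\mu\lambda^\star)^k\big)$, where $x^\star$ is the unique solution of the problem.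
   Context: Problem Properties: $g:\mathbb{R}^N\to\mathbb{R}\cup\{\infty\}$ is closed, convex and proper. For every $i\in\{1,\dots,n\}$, $f_i:\mathbb{R}^N\to\mathbb{R}$ is convex, differentiable and $L_i$-smooth. $F=\frac1n\sum_{i=1}^n f_i$ is $\mu$-strongly convex, differentiable and $L$-smooth with $L\le\frac1n\sum_{i=1}^nL_i$. Here a convex $f$ is $L$-smooth ($L>0$) if it is differentiable and $\langle\nabla f(x)-\nabla f(y),x-y\rangle\ge\frac1L\|\nabla f(x)-\nabla f(y)\|^2$ for all $x,y$ (equivalently, $\nabla f$ is $L$-Lipschitz), and $f$ is $\mu$-strongly convex ($\mu>0$) if $f-\frac\mu2\|\cdot\|^2$ is convex. The norm is Euclidean, and $\operatorname{prox}_{\lambda g}(z)=\arg\min_x \lambda g(x)+\frac12\|x-z\|^2$. SAGA algorithm: given initial points $x^0,y_1^0,\dots,y_n^0\in\mathbb{R}^N$ and step-size $\lambda>0$, for $k=0,1,\dots$ sample $I^k\in\{1,\dots,n\}$, independently and identically distributed over $k$ with $P(I^k=i)=p_i>0$, and set $$z^{k+1}=x^k-\tfrac{\lambda}{n}\Big(\tfrac1{p_{I^k}}(\nabla f_{I^k}(x^k)-y_{I^k}^k)+\sum_{i=1}^ny_i^k\Big),\quad x^{k+1}=\operatorname{prox}_{\lambda g}(z^{k+1}),$$ $y_{I^k}^{k+1}=\nabla f_{I^k}(x^k)$ and $y_i^{k+1}=y_i^k$ for $i\ne I^k$. The expected update frequency of the $i$th dual variable is $\eta_i=p_i$. Maximal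 step-size: the supremum of all $\lambda>0$ for which there exists $\rho\in(0,\min_i\eta_i)$ with $\rho=\mu\lambda(2-\nu(\rho)\lambda)$, where $\nu(\rho)=\min_{\delta>0}\max_i\big[(1+\delta^{-1})\frac{L_i}{np_i}\frac{\eta_i}{\eta_i-\rho}+(1+\delta)\frac{L_i}{np_i}-\delta\mu\big]$ if $\max_i\frac{L_i}{np_i}>\mu$, and $\nu(\rho)=\mu+\mu\max_i\frac{\eta_i}{\eta_i-\rho}$ if $\max_i\frac{L_i}{np_i}=\mu$ (this is the step-size condition guaranteeing linear convergence in the paper's general convergence theorem). "Recommended step-size" is just a name for $\lambda^\star$; its guaranteed property is the stated rate. *)

theory Defs
  imports
    "HOL-Probability.Probability"
    "HOL-Library.Landau_Symbols"
begin

definition grad :: "('a::real_inner \<Rightarrow> real) \<Rightarrow> 'a \<Rightarrow> 'a" where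
  "grad f x = (THE D. GDERIV f x :> D)"

definition smooth :: "real \<Rightarrow> ('a::real_inner \<Rightarrow> real) \<Rightarrow> bool" where
  "smooth L f \<longleftrightarrow> L > 0 \<and> (\<forall>x. f differentiable (at x)) \<and>
     (\<forall>x y. (grad f x - grad f y) \<bullet> (x - y) \<ge> 1 / L * (norm (grad f x - grad f y))\<^sup>2)"

definition strongly_convex :: "real \<Rightarrow> ('a::real_inner \<Rightarrow> real) \<Rightarrow> bool" where
  "strongly_convex \<mu> f \<longleftrightarrow> \<mu> > 0 \<and> convex_on UNIV (\<lambda>x. f x - \<mu> / 2 * (norm x)\<^sup>2)"

definition epi :: "('a \<Rightarrow> ereal) \<Rightarrow> ('a \<times> real) set" where
  "epi g = {(x, t). g x \<le> ereal t}"

text \<open>A map to the reals extended by \<open>\<infinity>\<close> is an \<^typ>\<open>ereal\<close>-valued function that avoids \<open>-\<infinity>\<close>;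
  convex and closed are meant in the sense of the epigraph.\<close>

definition closed_convex_proper :: "('a::euclidean_space \<Rightarrow> ereal) \<Rightarrow> bool" where
  "closed_convex_proper g \<longleftrightarrow>
     closed (epi g) \<and> convex (epi g) \<and> (\<forall>x. g x \<noteq> -\<infinity>) \<and> (\<exists>x. g x \<noteq> \<infinity>)"

definition prox :: "real \<Rightarrow> ('a::euclidean_space \<Rightarrow> ereal) \<Rightarrow> 'a \<Rightarrow> 'a" where
  "prox lam g z =
     arg_min (\<lambda>x. ereal lam * g x + ereal (1 / 2 * (norm (x - z))\<^sup>2)) (\<lambda>_. True)"

definition avg :: "nat \<Rightarrow> (nat \<Rightarrow> 'a \<Rightarrow> real) \<Rightarrow> 'a \<Rightarrow> real" where
  "avg n f x = 1 / real n * (\<Sum>i=1..n. f i x)"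

definition problem_properties ::
  "nat \<Rightarrow> ('a::euclidean_space \<Rightarrow> ereal) \<Rightarrow> (nat \<Rightarrow> 'a \<Rightarrow> real) \<Rightarrow> (nat \<Rightarrow> real) \<Rightarrow> real \<Rightarrow> real \<Rightarrow> bool"
where
  "problem_properties n g f Li L \<mu> \<longleftrightarrow>
     n \<ge> 1 \<and> closed_convex_proper g \<and>
     (\<forall>i\<in>{1..n}. convex_on UNIV (f i) \<and> smooth (Li i) (f i)) \<and>
     strongly_convex \<mu> (avg n f) \<and> smooth L (avg n f) \<and>
     L \<le> 1 / real n * (\<Sum>i=1..n. Li i)"

definition is_solution ::
  "nat \<Rightarrow> ('a::euclidean_space \<Rightarrow> ereal) \<Rightarrow> (nat \<Rightarrow> 'a \<Rightarrow> real) \<Rightarrow> 'a \<Rightarrow> bool" where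
  "is_solution n g f x \<longleftrightarrow> is_arg_min (\<lambda>x. g x + ereal (avg n f x)) (\<lambda>_. True) x"

definition iid_sampling ::
  "'w measure \<Rightarrow> nat \<Rightarrow> (nat \<Rightarrow> real) \<Rightarrow> (nat \<Rightarrow> 'w \<Rightarrow> nat) \<Rightarrow> bool" where
  "iid_sampling M n p I \<longleftrightarrow>
     prob_space M \<and> prob_space.indep_vars M (\<lambda>_. count_space {1..n}) I UNIV \<and>
     (\<forall>k. \<forall>i\<in>{1..n}. measure M {\<omega> \<in> space M. I k \<omega> = i} = p i) \<and>
     (\<forall>i\<in>{1..n}. p i > 0)"

text \<open>State \<open>(x\<^sup>k, y\<^sup>k)\<close> after \<open>k\<close> steps of SAGA, for one realisation \<open>s\<close> of the index sequence.\<close>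

primrec saga ::
  "nat \<Rightarrow> ('a::euclidean_space \<Rightarrow> ereal) \<Rightarrow> (nat \<Rightarrow> 'a \<Rightarrow> real) \<Rightarrow> (nat \<Rightarrow> real) \<Rightarrow> real \<Rightarrow>
   'a \<Rightarrow> (nat \<Rightarrow> 'a) \<Rightarrow> (nat \<Rightarrow> nat) \<Rightarrow> nat \<Rightarrow> 'a \<times> (nat \<Rightarrow> 'a)" where
  "saga n g f p lam x0 y0 s 0 = (x0, y0)"
| "saga n g f p lam x0 y0 s (Suc k) =
     (let (x, y) = saga n g f p lam x0 y0 s k;
          j = s k;
          z = x - (lam / real n) *\<^sub>R ((1 / p j) *\<^sub>R (grad (f j) x - y j) + (\<Sum>i=1..n. y i))
      in (prox lam g z, y(j := grad (f j) x)))"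

definition saga_x ::
  "nat \<Rightarrow> ('a::euclidean_space \<Rightarrow> ereal) \<Rightarrow> (nat \<Rightarrow> 'a \<Rightarrow> real) \<Rightarrow> (nat \<Rightarrow> real) \<Rightarrow> real \<Rightarrow>
   'a \<Rightarrow> (nat \<Rightarrow> 'a) \<Rightarrow> (nat \<Rightarrow> 'w \<Rightarrow> nat) \<Rightarrow> nat \<Rightarrow> 'w \<Rightarrow> 'a" where
  "saga_x n g f p lam x0 y0 I k \<omega> = fst (saga n g f p lam x0 y0 (\<lambda>m. I m \<omega>) k)"

text \<open>The second branch is meant for \<open>max\<^sub>i L\<^sub>i/(n p\<^sub>i) = \<mu>\<close>.  The maximum is never below \<open>\<mu>\<close>: since
  the \<open>p\<^sub>i\<close> sum to one, it is at least \<open>1/n \<Sum>\<^sub>i L\<^sub>i \<ge> L \<ge> \<mu>\<close>.  \<open>LEAST\<close> denotes the minimum over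
  \<open>\<delta> > 0\<close>, which is attained in the first branch.\<close>

definition nu ::
  "nat \<Rightarrow> (nat \<Rightarrow> real) \<Rightarrow> real \<Rightarrow> (nat \<Rightarrow> real) \<Rightarrow> (nat \<Rightarrow> real) \<Rightarrow> real \<Rightarrow> real" where
  "nu n Li \<mu> p \<eta> \<rho> =
     (if (MAX i\<in>{1..n}. Li i / (real n * p i)) > \<mu>
      then LEAST v. \<exists>\<delta>>0. v = (MAX i\<in>{1..n}.
             (1 + inverse \<delta>) * (Li i / (real n * p i)) * (\<eta> i / (\<eta> i - \<rho>))
             + (1 + \<delta>) * (Li i / (real n * p i)) - \<delta> * \<mu>)
      else \<mu> + \<mu> * (MAX i\<in>{1..n}. \<eta> i / (\<eta> i - \<rho>)))"

text \<open>The supremum is taken in \<^typ>\<open>ereal\<close>, so an equation with a real number also says that the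
  set of admissible step-sizes is nonempty and bounded.\<close>

definition max_step_size ::
  "nat \<Rightarrow> (nat \<Rightarrow> real) \<Rightarrow> real \<Rightarrow> (nat \<Rightarrow> real) \<Rightarrow> (nat \<Rightarrow> real) \<Rightarrow> ereal" where
  "max_step_size n Li \<mu> p \<eta> =
     (SUP lam\<in>{lam. lam > 0 \<and> (\<exists>\<rho>. 0 < \<rho> \<and> \<rho> < (MIN i\<in>{1..n}. \<eta> i) \<and>
                   \<rho> = \<mu> * lam * (2 - nu n Li \<mu> p \<eta> \<rho> * lam))}. ereal lam)"

end

theory Submission
  imports Defs
begin

text \<open>Both sampling schemes are instances of one situation: some index \<open>i0\<close> has at the same time the largest
ratio \<open>K = L\<^sub>i / (n p\<^sub>i)\<close> and the smallest probability. For \<open>p\<^sub>i = 1/n\<close> this is an index of maximal \<open>L\<^sub>i\<close>,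
with \<open>K = L\<^sub>m\<^sub>a\<^sub>x\<close>; for \<open>p\<^sub>i\<close> proportional to \<open>L\<^sub>i\<close> all ratios equal the mean of the \<open>L\<^sub>i\<close>, and an index of
minimal \<open>p\<^sub>i\<close> works. Lemma \<open>saga_step_sizes\<close> treats this situation. Throughout, \<open>s = sqrt (1 - \<mu>/K)\<close>,
\<open>C = 2 (1 + s)\<close>, \<open>p\<^sub>m\<close> is the smallest probability and \<open>a(\<rho>) = p\<^sub>m / (p\<^sub>m - \<rho>)\<close>.

\<^emph>\<open>Maximal step-size.\<close> In the definition of \<open>\<nu>(\<rho>)\<close> all maxima are attained at \<open>i0\<close>, and minimising
over \<open>\<delta>\<close> is the inequality of arithmetic and geometric means. Both branches become
\<open>\<nu>(\<rho>) = K a + K + 2 sqrt (K a (K - \<mu>))\<close>, which increases with \<open>\<rho>\<close>, has \<open>\<nu>(0) = C K\<close> and blows up at \<open>p\<^sub>m\<close>.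
Hence an admissible \<open>\<lambda>\<close> satisfies \<open>\<lambda> C K < 2\<close>, and for every such \<open>\<lambda> > 0\<close> the intermediate value theorem
gives a suitable \<open>\<rho>\<close>: the admissible step-sizes are exactly the interval from \<open>0\<close> to \<open>2 / (C K)\<close>.

\<^emph>\<open>Rate.\<close> The recommended \<open>\<lambda>\<close> solves \<open>\<lambda> K (1 + s) (1 + a(\<rho>)) = 1\<close> with \<open>\<rho> = \<mu> \<lambda>\<close>. Put
\<open>\<Delta> = x\<^sup>k - x\<^sup>*\<close>, \<open>e\<^sub>i = y\<^sub>i - \<nabla>f\<^sub>i(x\<^sup>*)\<close>, \<open>d\<^sub>i = \<nabla>f\<^sub>i(x\<^sup>k) - \<nabla>f\<^sub>i(x\<^sup>*)\<close>, and let \<open>D = 1/n \<Sum>\<^sub>i d\<^sub>i\<close>, \<open>q = \<langle>D, \<Delta>\<rangle>\<close>. The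
expectation of the Lyapunov function \<open>\<parallel>\<Delta>\<parallel>\<^sup>2 + \<Sum>\<^sub>i \<gamma>\<^sub>i \<parallel>e\<^sub>i\<parallel>\<^sup>2\<close> shrinks by \<open>1 - \<rho>\<close> in each step
(\<open>expected_lyapunov_step\<close>). Indeed, as the proximal map is nonexpansive, the primal term becomes at most
\<open>\<parallel>\<Delta>\<parallel>\<^sup>2 - 2 \<lambda> q + \<lambda>\<^sup>2 \<bbbE>\<parallel>W\<parallel>\<^sup>2\<close>, where \<open>W\<close> is the gradient estimate minus \<open>\<nabla>F(x\<^sup>*)\<close>. By cocoercivity of the
\<open>\<nabla>f\<^sub>i\<close> the second moment of \<open>d\<^sub>I / (n p\<^sub>I)\<close> is at most \<open>K q\<close>, and by strong convexity its mean has
\<open>\<parallel>D\<parallel>\<^sup>2 \<ge> \<mu> q\<close>; its variance is therefore at most \<open>(K - \<mu>) q = s\<^sup>2 K q\<close>. Young's inequality with weight \<open>s\<close> then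
bounds \<open>\<bbbE>\<parallel>W\<parallel>\<^sup>2\<close> by \<open>(1 + s) K q\<close> plus \<open>1 + s\<close> times the second moment of \<open>e\<^sub>I / (n p\<^sub>I)\<close>. The weights \<open>\<gamma>\<^sub>i\<close> are
chosen so that the dual terms shrink by exactly \<open>1 - \<rho>\<close> after absorbing this second moment; what they
cost is another \<open>\<lambda>\<^sup>2 (1 + s) K a q\<close>. By the choice of \<open>\<lambda>\<close> all this adds up to \<open>\<lambda> q\<close>, so that
\<open>\<parallel>\<Delta>\<parallel>\<^sup>2 - \<lambda> q \<le> (1 - \<rho>) \<parallel>\<Delta>\<parallel>\<^sup>2\<close> remains. Independence of \<open>I\<^sup>k\<close> from the past turns this into a statement on
expectations over \<open>k\<close> steps.\<close>

section \<open>Gradients of convex functions\<close>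

lemma GDERIV_unique:
  fixes f :: "'a::real_inner \<Rightarrow> real"
  assumes "GDERIV f x :> D" "GDERIV f x :> D'"
  shows "D = D'"
proof -
  have "(\<lambda>h. h \<bullet> D) = (\<lambda>h. h \<bullet> D')"
    using assms unfolding gderiv_def by (rule has_derivative_unique)
  then show ?thesis
    by (metis vector_eq_ldot)
qed

lemma grad_eqI: "GDERIV f x :> D \<Longrightarrow> grad f x = D"
  unfolding grad_def using GDERIV_unique by blast

lemma GDERIV_grad:
  fixes f :: "'a::euclidean_space \<Rightarrow> real"
  assumes "f differentiable (at x)"
  shows "GDERIV f x :> grad f x"
proof -
  obtain f' where f': "(f has_derivative f') (at x)"
    using assms by (auto simp: differentiable_def)
  define D where "D = (\<Sum>b\<in>Basis. f' b *\<^sub>R b)"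
  have "f' h = h \<bullet> D" for h
  proof -
    interpret linear f'
      using f' by (rule has_derivative_linear)
    have "f' h = f' (\<Sum>b\<in>Basis. (h \<bullet> b) *\<^sub>R b)"
      by (simp add: euclidean_representation)
    also have "\<dots> = h \<bullet> D"
      by (simp add: sum scale D_def inner_sum_right mult.commute)
    finally show ?thesis .
  qed
  then have "f' = (\<lambda>h. h \<bullet> D)" by blast
  with f' have "GDERIV f x :> D" by (simp add: gderiv_def)
  then show ?thesis by (simp add: grad_eqI)
qed

text \<open>The one limit argument behind both the gradient inequality and the optimality condition of a minimiser:
along \<open>d\<close>, difference quotients that are at least \<open>c\<close> force a directional derivative of at least \<open>c\<close>.\<close>

lemma GDERIV_lower_bound:
  fixes h :: "'a::real_inner \<Rightarrow> real"
  assumes D: "GDERIV h x :> D"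
    and ge: "\<And>t. \<lbrakk>0 < t; t < 1\<rbrakk> \<Longrightarrow> t * c \<le> h (x + t *\<^sub>R d) - h x"
  shows "c \<le> d \<bullet> D"
proof -
  have "((\<lambda>t. h (x + t *\<^sub>R d)) has_derivative (\<lambda>t. (t *\<^sub>R d) \<bullet> D)) (at (0::real))"
    by (rule has_derivative_compose[where g = h and f = "\<lambda>t. x + t *\<^sub>R d"])
       (use D in \<open>auto simp: gderiv_def intro!: derivative_eq_intros\<close>)
  then have "((\<lambda>t. h (x + t *\<^sub>R d)) has_real_derivative (d \<bullet> D)) (at 0)"
    by (simp add: has_field_derivative_def mult.commute[of _ "d \<bullet> D"])
  then have "((\<lambda>t. (h (x + t *\<^sub>R d) - h x) / t) \<longlongrightarrow> d \<bullet> D) (at_right 0)"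
    by (auto simp: DERIV_def intro: tendsto_mono[OF at_le])
  moreover have "eventually (\<lambda>t. c \<le> (h (x + t *\<^sub>R d) - h x) / t) (at_right (0::real))"
    unfolding eventually_at_right_field
    by (rule exI[of _ 1]) (use ge in \<open>auto simp: field_simps\<close>)
  ultimately show ?thesis
    by (rule tendsto_lowerbound) simp
qed

lemma convex_above_tangent:
  fixes f :: "'a::real_inner \<Rightarrow> real"
  assumes "convex_on UNIV f" and D: "GDERIV f x :> D"
  shows "f x + (y - x) \<bullet> D \<le> f y"
proof -
  have "f x - f y \<le> (y - x) \<bullet> (- D)"
  proof (rule GDERIV_lower_bound)
    show "GDERIV (\<lambda>x. - f x) x :> - D"
      by (rule GDERIV_minus[OF D])
    fix t :: real assume t: "0 < t" "t < 1"
    have "f ((1 - t) *\<^sub>R x + t *\<^sub>R y) \<le> (1 - t) * f x + t * f y"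
      using assms(1) t by (intro convex_onD) auto
    then show "t * (f x - f y) \<le> - f (x + t *\<^sub>R (y - x)) - - f x"
      by (simp add: algebra_simps)
  qed
  then show ?thesis by simp
qed

lemma strongly_convex_above_parabola:
  fixes f :: "'a::real_inner \<Rightarrow> real"
  assumes sc: "strongly_convex \<mu> f" and D: "GDERIV f x :> D"
  shows "f x + (y - x) \<bullet> D + \<mu> / 2 * (norm (y - x))\<^sup>2 \<le> f y"
proof -
  have "GDERIV (\<lambda>x. f x - \<mu> / 2 * (norm x)\<^sup>2) x :> D - \<mu> *\<^sub>R x"
    using D unfolding gderiv_def power2_norm_eq_inner
    by (auto intro!: derivative_eq_intros simp: algebra_simps inner_commute)
  from convex_above_tangent[OF _ this, of y] sc
  have "f x - \<mu> / 2 * (x \<bullet> x) + (y - x) \<bullet> (D - \<mu> *\<^sub>R x) \<le> f y - \<mu> / 2 * (y \<bullet> y)"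
    by (simp add: strongly_convex_def power2_norm_eq_inner)
  then show ?thesis
    by (simp add: power2_norm_eq_inner algebra_simps inner_commute)
qed

lemma strongly_convex_gradient_monotone:
  fixes f :: "'a::real_inner \<Rightarrow> real"
  assumes "strongly_convex \<mu> f" "GDERIV f x :> D" "GDERIV f y :> E"
  shows "\<mu> * (norm (x - y))\<^sup>2 \<le> (x - y) \<bullet> (D - E)"
  using strongly_convex_above_parabola[OF assms(1,2), of y]
    strongly_convex_above_parabola[OF assms(1,3), of x]
  by (simp add: norm_minus_commute algebra_simps)

section \<open>Minimisers and proximal points\<close>

text \<open>Separate the closed convex epigraph from a point strictly below it. The separating hyperplane is not
vertical because that point lies under a point of the epigraph.\<close>

lemma affine_minorant:
  fixes g :: "'a::euclidean_space \<Rightarrow> ereal"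
  assumes "closed_convex_proper g"
  obtains u c where "\<And>x t. g x \<le> ereal t \<Longrightarrow> c + u \<bullet> x \<le> t"
proof -
  obtain x0 where "g x0 \<noteq> \<infinity>" "g x0 \<noteq> - \<infinity>"
    using assms by (auto simp: closed_convex_proper_def)
  then obtain t0 where t0: "g x0 = ereal t0" by (cases "g x0") auto
  have "(x0, t0 - 1) \<notin> epi g" by (simp add: epi_def t0)
  then obtain a b where a: "a \<bullet> (x0, t0 - 1) < b" "\<forall>z\<in>epi g. b < a \<bullet> z"
    using separating_hyperplane_closed_point[of "epi g" "(x0, t0 - 1)"] assms
    by (auto simp: closed_convex_proper_def)
  obtain w \<alpha> where w: "a = (w, \<alpha>)" by (cases a)
  have "b < a \<bullet> (x0, t0)" using a(2) t0 by (auto simp: epi_def)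
  with a(1) have pos: "\<alpha> > 0" by (simp add: w algebra_simps)
  show thesis
  proof (rule that)
    fix x t assume "g x \<le> ereal t"
    then have "b < w \<bullet> x + \<alpha> * t" using a(2) by (auto simp: epi_def w)
    then have "b / \<alpha> + - (w \<bullet> x) / \<alpha> \<le> t"
      using pos by (simp add: field_simps)
    then show "b / \<alpha> + ((- 1 / \<alpha>) *\<^sub>R w) \<bullet> x \<le> t" by simp
  qed
qed

text \<open>The quadratic growth of \<open>h\<close> beats the affine minorant of \<open>g\<close>, so the part of the epigraph of \<open>g\<close> on which
\<open>t + h x\<close> does not exceed a given finite value of \<open>g + h\<close> is compact. Minimising the continuous function
\<open>t + h x\<close> there replaces semicontinuity of \<open>g\<close>. This yields solutions of the problem and well-defined
proximal points alike.\<close>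

lemma exists_minimizer:
  fixes g :: "'a::euclidean_space \<Rightarrow> ereal"
  assumes g: "closed_convex_proper g" and cont: "continuous_on UNIV h"
    and m: "m > 0" and h: "\<And>x. c + v \<bullet> x + m * (norm x)\<^sup>2 \<le> h x"
  shows "\<exists>x. is_arg_min (\<lambda>x. g x + ereal (h x)) (\<lambda>_. True) x"
proof -
  obtain u b where minor: "\<And>x t. g x \<le> ereal t \<Longrightarrow> b + u \<bullet> x \<le> t"
    by (rule affine_minorant[OF g]) blast
  obtain x0 where "g x0 \<noteq> \<infinity>" "g x0 \<noteq> - \<infinity>"
    using g by (auto simp: closed_convex_proper_def)
  then obtain t0 where t0: "g x0 = ereal t0" by (cases "g x0") auto
  define C where "C = t0 + h x0"
  define S where "S = epi g \<inter> {z. snd z + h (fst z) \<le> C}"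
  have cont': "continuous_on UNIV (\<lambda>z::'a \<times> real. snd z + h (fst z))"
    by (intro continuous_intros continuous_on_compose2[OF cont]) auto
  have "closed S"
    using g cont' unfolding S_def closed_convex_proper_def
    by (intro closed_Int closed_Collect_le) auto
  \<comment> \<open>Outside of the unit ball, \<open>m \<parallel>x\<parallel>\<^sup>2 \<le> const + \<parallel>u + v\<parallel> \<parallel>x\<parallel>\<close> gives \<open>m \<parallel>x\<parallel> \<le> const + \<parallel>u + v\<parallel>\<close>.\<close>
  define R where "R = max 1 ((\<bar>C - b - c\<bar> + norm (u + v)) / m)"
  have "bounded S"
  proof -
    have "z \<in> cball 0 R \<times> {b - norm u * R .. C - c + norm v * R}" if "z \<in> S" for z
    proof -
      obtain x t where z: "z = (x, t)" by (cases z)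
      have t: "b + u \<bullet> x \<le> t" "t + h x \<le> C"
        using that minor by (auto simp: S_def z epi_def)
      have uvx: "- (norm (u + v) * norm x) \<le> (u + v) \<bullet> x"
        using Cauchy_Schwarz_ineq2[of "u + v" x] by linarith
      have le: "m * (norm x)\<^sup>2 \<le> \<bar>C - b - c\<bar> + norm (u + v) * norm x"
        using t h[of x] uvx by (simp add: inner_left_distrib)
      have R: "norm x \<le> R"
      proof (cases "norm x \<le> 1")
        case False
        then have "\<bar>C - b - c\<bar> \<le> \<bar>C - b - c\<bar> * norm x"
          by (simp add: mult_le_cancel_left1)
        with le have "(m * norm x) * norm x \<le> (\<bar>C - b - c\<bar> + norm (u + v)) * norm x"
          by (simp add: power2_eq_square algebra_simps)
        with False have "m * norm x \<le> \<bar>C - b - c\<bar> + norm (u + v)"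
          by (auto simp: mult_le_cancel_right)
        then have "norm x \<le> (\<bar>C - b - c\<bar> + norm (u + v)) / m"
          using m by (simp add: field_simps)
        then show ?thesis by (simp add: R_def)
      qed (simp add: R_def)
      have "\<bar>w \<bullet> x\<bar> \<le> norm w * R" for w
        using Cauchy_Schwarz_ineq2[of w x] mult_left_mono[OF R, of "norm w"] by simp
      from this[of u] this[of v] have "- (norm u * R) \<le> u \<bullet> x" "- (norm v * R) \<le> v \<bullet> x"
        by linarith+
      moreover have "0 \<le> m * (norm x)\<^sup>2" using m by simp
      ultimately show ?thesis
        using t h[of x] R unfolding z mem_Times_iff fst_conv snd_conv atLeastAtMost_iff mem_cball_0
        by linarith
    qed
    then show ?thesis
      by (intro bounded_subset[OF bounded_Times[OF bounded_cball bounded_closed_interval]]) blast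
  qed
  with \<open>closed S\<close> have "compact S" by (simp add: compact_eq_bounded_closed)
  moreover have "(x0, t0) \<in> S" by (simp add: S_def epi_def t0 C_def)
  ultimately obtain z where z: "z \<in> S" "\<And>w. w \<in> S \<Longrightarrow> snd z + h (fst z) \<le> snd w + h (fst w)"
    using continuous_attains_inf[of S "\<lambda>z. snd z + h (fst z)"]
      continuous_on_subset[OF cont'] by blast
  obtain x t where xt: "z = (x, t)" by (cases z)
  have "g x + ereal (h x) \<le> g y + ereal (h y)" for y
  proof -
    have gx: "g x \<le> ereal t" using z(1) by (simp add: S_def epi_def xt)
    have "g y \<noteq> - \<infinity>" using g by (simp add: closed_convex_proper_def)
    then consider "g y = \<infinity>" | r where "g y = ereal r" by (cases "g y") auto
    then show ?thesis
    proof cases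
      case 2
      have "t + h x \<le> r + h y"
      proof (cases "r + h y \<le> C")
        case True
        then have "(y, r) \<in> S" by (simp add: S_def epi_def 2)
        from z(2)[OF this] show ?thesis by (simp add: xt)
      next
        case False
        with z(1) show ?thesis by (simp add: S_def xt)
      qed
      then have "ereal t + ereal (h x) \<le> g y + ereal (h y)" by (simp add: 2)
      with gx show ?thesis by (meson add_right_mono order_trans)
    qed simp
  qed
  then show ?thesis
    unfolding is_arg_min_def by (auto simp: not_less intro!: exI[of _ x])
qed

text \<open>Finiteness of \<open>g x\<close> is included: where \<open>g x = \<infinity>\<close>, the inequality would compare infinities.\<close>

definition subgradient :: "('a::real_inner \<Rightarrow> ereal) \<Rightarrow> 'a \<Rightarrow> 'a \<Rightarrow> bool" where
  "subgradient g x w \<longleftrightarrow> \<bar>g x\<bar> \<noteq> \<infinity> \<and> (\<forall>y. g x + ereal ((y - x) \<bullet> w) \<le> g y)"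

lemma subgradient_monotone:
  assumes "subgradient g x u" "subgradient g y w"
  shows "0 \<le> (x - y) \<bullet> (u - w)"
proof -
  obtain a b where ab: "g x = ereal a" "g y = ereal b"
    using assms by (auto simp: subgradient_def)
  have "g x + ereal ((y - x) \<bullet> u) \<le> g y" "g y + ereal ((x - y) \<bullet> w) \<le> g x"
    using assms by (auto simp: subgradient_def)
  then show ?thesis
    by (simp add: ab algebra_simps)
qed

text \<open>Fermat's rule for a convex plus a differentiable function: minimality along the segment from \<open>x\<close> to \<open>y\<close>
and convexity of \<open>g\<close> bound the difference quotients of \<open>h\<close> from below by \<open>g x - g y\<close>.\<close>

lemma minimizer_subgradient:
  fixes g :: "'a::euclidean_space \<Rightarrow> ereal"
  assumes g: "closed_convex_proper g" and D: "GDERIV h x :> D"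
    and x: "is_arg_min (\<lambda>x. g x + ereal (h x)) (\<lambda>_. True) x"
  shows "subgradient g x (- D)"
proof -
  have min: "g x + ereal (h x) \<le> g y + ereal (h y)" for y
    using x by (simp add: is_arg_min_linorder)
  have ninf: "g y \<noteq> - \<infinity>" for y
    using g by (simp add: closed_convex_proper_def)
  obtain x0 where "g x0 \<noteq> \<infinity>"
    using g by (auto simp: closed_convex_proper_def)
  with min[of x0] ninf[of x] obtain a where a: "g x = ereal a"
    by (cases "g x"; cases "g x0") auto
  have "g x + ereal ((y - x) \<bullet> - D) \<le> g y" for y
  proof -
    consider "g y = \<infinity>" | b where "g y = ereal b"
      using ninf[of y] by (cases "g y") auto
    then show ?thesis
    proof cases
      case 2
      have "a - b \<le> (y - x) \<bullet> D"
      proof (rule GDERIV_lower_bound[OF D])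
        fix t :: real assume t: "0 < t" "t < 1"
        define z where "z = x + t *\<^sub>R (y - x)"
        have "(1 - t) *\<^sub>R (x, a) + t *\<^sub>R (y, b) \<in> epi g"
          using g t a 2 unfolding closed_convex_proper_def
          by (intro convexD) (auto simp: epi_def)
        moreover have "(1 - t) *\<^sub>R (x, a) + t *\<^sub>R (y, b) = (z, (1 - t) * a + t * b)"
          by (simp add: z_def algebra_simps)
        ultimately have "g z \<le> ereal ((1 - t) * a + t * b)"
          by (simp add: epi_def)
        then have "g x + ereal (h x) \<le> ereal ((1 - t) * a + t * b) + ereal (h z)"
          using min[of z] by (meson add_right_mono order_trans)
        then show "t * (a - b) \<le> h (x + t *\<^sub>R (y - x)) - h x"
          by (simp add: a z_def algebra_simps)
      qed
      then show ?thesis by (simp add: a 2)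
    qed simp
  qed
  then show ?thesis by (simp add: subgradient_def a)
qed

lemma closed_convex_proper_scale:
  fixes g :: "'a::euclidean_space \<Rightarrow> ereal"
  assumes "closed_convex_proper g" "lam > 0"
  shows "closed_convex_proper (\<lambda>x. ereal lam * g x)"
proof -
  define s :: "'a \<times> real \<Rightarrow> 'a \<times> real" where "s = (\<lambda>z. (fst z, snd z / lam))"
  have "ereal lam * g x \<le> ereal t \<longleftrightarrow> g x \<le> ereal (t / lam)" for x t
    using assms(2) by (cases "g x") (auto simp: field_simps)
  then have epi: "epi (\<lambda>x. ereal lam * g x) = s -` epi g"
    by (auto simp: epi_def s_def)
  have "linear s"
    by (rule linearI) (auto simp: s_def add_divide_distrib)
  moreover have "continuous_on UNIV s"
    unfolding s_def by (intro continuous_intros) (use assms(2) in auto)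
  moreover have "ereal lam * g x \<noteq> - \<infinity>" "ereal lam * g x = \<infinity> \<longleftrightarrow> g x = \<infinity>" for x
    using assms by (cases "g x"; auto simp: closed_convex_proper_def)+
  ultimately show ?thesis
    using assms(1) unfolding closed_convex_proper_def epi
    by (auto intro: convex_linear_vimage closed_vimage)
qed

lemma prox_subgradient:
  fixes g :: "'a::euclidean_space \<Rightarrow> ereal"
  assumes g: "closed_convex_proper g" and lam: "lam > 0"
  shows "subgradient (\<lambda>x. ereal lam * g x) (prox lam g z) (z - prox lam g z)"
proof -
  define h where "h = (\<lambda>x::'a. 1 / 2 * (norm (x - z))\<^sup>2)"
  have g': "closed_convex_proper (\<lambda>x. ereal lam * g x)"
    by (rule closed_convex_proper_scale[OF assms])
  have "\<exists>x. is_arg_min (\<lambda>x. ereal lam * g x + ereal (h x)) (\<lambda>_. True) x"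
  proof (rule exists_minimizer[OF g'])
    show "continuous_on UNIV h"
      unfolding h_def by (intro continuous_intros)
    show "1 / 2 * (norm z)\<^sup>2 + (- z) \<bullet> x + 1 / 2 * (norm x)\<^sup>2 \<le> h x" for x
      by (simp add: h_def power2_norm_eq_inner inner_commute algebra_simps)
  qed simp
  then have "is_arg_min (\<lambda>x. ereal lam * g x + ereal (h x)) (\<lambda>_. True) (prox lam g z)"
    unfolding prox_def arg_min_def h_def by (rule someI_ex)
  moreover have "GDERIV h x :> x - z" for x
    unfolding h_def gderiv_def power2_norm_eq_inner
    by (auto intro!: derivative_eq_intros simp: algebra_simps inner_commute)
  ultimately show ?thesis
    using minimizer_subgradient[OF g', of h] by fastforce
qed

text \<open>The case of nonexpansiveness of the proximal map that the convergence proof uses: \<open>x\<close> is the proximal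
point of \<open>x + lam w\<close>, a fact that enters only as a subgradient inequality at \<open>x\<close>. Monotonicity of the
subdifferential and the Cauchy-Schwarz inequality give the claim.\<close>

lemma prox_contracts_to_subgradient_point:
  fixes g :: "'a::euclidean_space \<Rightarrow> ereal"
  assumes g: "closed_convex_proper g" and lam: "lam > 0" and w: "subgradient g x w"
  shows "norm (prox lam g z - x) \<le> norm (z - (x + lam *\<^sub>R w))"
proof -
  let ?q = "prox lam g z" and ?z = "x + lam *\<^sub>R w"
  have "subgradient (\<lambda>x. ereal lam * g x) x (?z - x)"
    unfolding subgradient_def
  proof (intro conjI allI)
    obtain a where a: "g x = ereal a" using w by (auto simp: subgradient_def)
    then show "\<bar>ereal lam * g x\<bar> \<noteq> \<infinity>" by simp
    fix y
    have "g x + ereal ((y - x) \<bullet> w) \<le> g y"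
      using w by (simp add: subgradient_def)
    then have "ereal lam * (g x + ereal ((y - x) \<bullet> w)) \<le> ereal lam * g y"
      using lam by (intro ereal_mult_left_mono) auto
    then show "ereal lam * g x + ereal ((y - x) \<bullet> (?z - x)) \<le> ereal lam * g y"
      by (simp add: a algebra_simps)
  qed
  then have "0 \<le> (?q - x) \<bullet> ((z - ?q) - (?z - x))"
    by (intro subgradient_monotone[OF prox_subgradient[OF g lam]])
  then have "(norm (?q - x))\<^sup>2 \<le> (?q - x) \<bullet> (z - ?z)"
    by (simp add: power2_norm_eq_inner algebra_simps)
  also have "\<dots> \<le> norm (?q - x) * norm (z - ?z)"
    using Cauchy_Schwarz_ineq2 abs_le_D1 by blast
  finally show ?thesis
    by (cases "?q = x") (auto simp: power2_eq_square)
qed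

lemma GDERIV_avg:
  fixes f :: "nat \<Rightarrow> 'a::euclidean_space \<Rightarrow> real"
  assumes "\<And>i. i \<in> {1..n} \<Longrightarrow> f i differentiable (at x)"
  shows "GDERIV (avg n f) x :> (1 / real n) *\<^sub>R (\<Sum>i=1..n. grad (f i) x)"
proof -
  have "((\<lambda>x. 1 / real n * (\<Sum>i=1..n. f i x)) has_derivative
      (\<lambda>h. 1 / real n * (\<Sum>i=1..n. h \<bullet> grad (f i) x))) (at x)"
    using GDERIV_grad[OF assms] unfolding gderiv_def
    by (intro has_derivative_mult_right has_derivative_sum) auto
  then show ?thesis
    unfolding gderiv_def avg_def[abs_def] by (simp add: inner_sum_right)
qed

lemma ex1_solution:
  assumes "problem_properties n g f Li L \<mu>"
  shows "\<exists>!x. is_solution n g f x"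
proof -
  let ?F = "avg n f"
  have g: "closed_convex_proper g" and sc: "strongly_convex \<mu> ?F"
    and diff: "\<And>x. ?F differentiable (at x)"
    using assms by (auto simp: problem_properties_def smooth_def)
  note D = GDERIV_grad[OF diff]
  show ?thesis
  proof (rule ex_ex1I)
    have "\<exists>x. is_arg_min (\<lambda>x. g x + ereal (?F x)) (\<lambda>_. True) x"
    proof (rule exists_minimizer[OF g])
      show "continuous_on UNIV ?F"
        using diff by (simp add: continuous_at_imp_continuous_on differentiable_imp_continuous_within)
      show "\<mu> / 2 > 0" using sc by (simp add: strongly_convex_def)
      show "?F 0 + grad ?F 0 \<bullet> x + \<mu> / 2 * (norm x)\<^sup>2 \<le> ?F x" for x
        using strongly_convex_above_parabola[OF sc D, of 0 x] by (simp add: inner_commute)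
    qed
    then show "\<exists>x. is_solution n g f x" by (simp add: is_solution_def)
  next
    fix x y assume "is_solution n g f x" "is_solution n g f y"
    then have "0 \<le> (x - y) \<bullet> (- grad ?F x - - grad ?F y)"
      unfolding is_solution_def
      by (intro subgradient_monotone[of g] minimizer_subgradient[OF g D])
    then have "0 \<le> - ((x - y) \<bullet> (grad ?F x - grad ?F y))"
      by (simp add: algebra_simps)
    moreover have "\<mu> * (norm (x - y))\<^sup>2 \<le> (x - y) \<bullet> (grad ?F x - grad ?F y)"
      by (rule strongly_convex_gradient_monotone[OF sc D D])
    ultimately have "\<mu> * (norm (x - y))\<^sup>2 \<le> 0" by linarith
    then show "x = y"
      using sc by (simp add: strongly_convex_def mult_le_0_iff)
  qed
qed

lemma smooth_cocoercive:
  assumes "smooth L f"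
  shows "(norm (grad f x - grad f y))\<^sup>2 \<le> L * ((grad f x - grad f y) \<bullet> (x - y))"
proof -
  have "L > 0"
    "1 / L * (norm (grad f x - grad f y))\<^sup>2 \<le> (grad f x - grad f y) \<bullet> (x - y)"
    using assms by (auto simp: smooth_def)
  then show ?thesis by (simp add: field_simps)
qed

text \<open>Along a unit vector \<open>b\<close> the gradient changes by at least \<open>\<mu>\<close> and at most \<open>L\<close>. A unit vector exists as
Euclidean spaces have positive dimension.\<close>

lemma strong_convexity_le_smoothness:
  fixes f :: "'a::euclidean_space \<Rightarrow> real"
  assumes "strongly_convex \<mu> f" "smooth L f"
  shows "\<mu> \<le> L"
proof -
  obtain b :: 'a where b: "norm b = 1"
    using nonempty_Basis norm_Basis by blast
  have D: "GDERIV f x :> grad f x" for x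
    using assms(2) by (intro GDERIV_grad) (simp add: smooth_def)
  define d where "d = grad f b - grad f 0"
  have "L > 0" using assms(2) by (simp add: smooth_def)
  have mono: "\<mu> \<le> d \<bullet> b"
    using strongly_convex_gradient_monotone[OF assms(1) D D, of b 0]
    by (simp add: d_def b inner_commute)
  have coco: "(norm d)\<^sup>2 \<le> L * (d \<bullet> b)"
    using smooth_cocoercive[OF assms(2), of b 0] by (simp add: d_def)
  have le: "d \<bullet> b \<le> norm d"
    using Cauchy_Schwarz_ineq2[of d b] b by simp
  have "\<mu> > 0" using assms(1) by (simp add: strongly_convex_def)
  with mono le have "norm d > 0" by linarith
  have "norm d * norm d \<le> L * norm d"
    using coco le \<open>L > 0\<close> by (metis less_imp_le mult_left_mono order_trans power2_eq_square)
  with \<open>norm d > 0\<close> have "norm d \<le> L" by simp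
  with mono le show ?thesis by linarith
qed

section \<open>Variance of the gradient estimate\<close>

lemma weighted_variance:
  fixes X :: "'i \<Rightarrow> 'a::real_inner"
  assumes "(\<Sum>i\<in>A. p i) = 1"
  defines "m \<equiv> \<Sum>i\<in>A. p i *\<^sub>R X i"
  shows "(\<Sum>i\<in>A. p i * (norm (X i - m))\<^sup>2) = (\<Sum>i\<in>A. p i * (norm (X i))\<^sup>2) - (norm m)\<^sup>2"
proof -
  have "p i * (norm (X i - m))\<^sup>2
      = p i * (norm (X i))\<^sup>2 - 2 * ((p i *\<^sub>R X i) \<bullet> m) + p i * (norm m)\<^sup>2" for i
    by (simp add: power2_norm_eq_inner inner_commute algebra_simps)
  then have "(\<Sum>i\<in>A. p i * (norm (X i - m))\<^sup>2)
      = (\<Sum>i\<in>A. p i * (norm (X i))\<^sup>2) - 2 * (m \<bullet> m) + (norm m)\<^sup>2"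
    by (simp add: sum.distrib sum_subtractf m_def inner_sum_left assms(1)
        flip: sum_distrib_left sum_distrib_right)
  then show ?thesis by (simp add: power2_norm_eq_inner)
qed

lemma norm_diff_squared_young:
  fixes u v :: "'a::real_inner"
  assumes "s > 0"
  shows "(norm (u - v))\<^sup>2 \<le> (1 + 1 / s) * (norm u)\<^sup>2 + (1 + s) * (norm v)\<^sup>2"
proof -
  have "0 \<le> (norm (u + s *\<^sub>R v))\<^sup>2 / s" using assms by simp
  also have "\<dots> = (norm u)\<^sup>2 / s + 2 * (u \<bullet> v) + s * (norm v)\<^sup>2"
    using assms
    by (simp add: power2_norm_eq_inner inner_commute inner_add_left inner_add_right field_simps)
  finally show ?thesis
    by (simp add: power2_norm_eq_inner inner_commute algebra_simps)
qed

text \<open>Here \<open>U\<close> is the gradient estimator and \<open>E\<close> its control variate. Young's inequality with weights \<open>1 + 1/s\<close>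
and \<open>1 + s\<close> is applied to the centred variables; the variance of \<open>U\<close> has a factor \<open>s\<^sup>2\<close>, which turns the
factor \<open>1/s\<close> into the term \<open>s Q\<close>. For \<open>s = 0\<close>, where Young's inequality breaks down,
\<open>U\<close> has variance zero and therefore equals its mean at all indices of positive weight.\<close>

lemma variance_reduced_second_moment:
  fixes U E :: "'i \<Rightarrow> 'a::real_inner"
  assumes fin: "finite A" and p: "\<And>i. i \<in> A \<Longrightarrow> 0 \<le> p i" "(\<Sum>i\<in>A. p i) = 1" and s: "0 \<le> s"
    and var: "(\<Sum>i\<in>A. p i * (norm (U i))\<^sup>2) - (norm (\<Sum>i\<in>A. p i *\<^sub>R U i))\<^sup>2 \<le> s\<^sup>2 * Q"
  shows "(\<Sum>i\<in>A. p i * (norm (U i - (E i - (\<Sum>j\<in>A. p j *\<^sub>R E j))))\<^sup>2)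
    \<le> (\<Sum>i\<in>A. p i * (norm (U i))\<^sup>2) + s * Q + (1 + s) * (\<Sum>i\<in>A. p i * (norm (E i))\<^sup>2)"
proof -
  define D where "D = (\<Sum>i\<in>A. p i *\<^sub>R U i)"
  define m where "m = (\<Sum>i\<in>A. p i *\<^sub>R E i)"
  define a where "a = (\<Sum>i\<in>A. p i * (norm (U i - D))\<^sup>2)"
  define b where "b = (\<Sum>i\<in>A. p i * (norm (E i - m))\<^sup>2)"
  have a: "a = (\<Sum>i\<in>A. p i * (norm (U i))\<^sup>2) - (norm D)\<^sup>2"
    unfolding a_def D_def by (rule weighted_variance[OF p(2)])
  have b: "b = (\<Sum>i\<in>A. p i * (norm (E i))\<^sup>2) - (norm m)\<^sup>2"
    unfolding b_def m_def by (rule weighted_variance[OF p(2)])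
  have "(\<Sum>i\<in>A. p i *\<^sub>R (U i - (E i - m))) = D"
    using p(2) by (simp add: scaleR_diff_right sum_subtractf D_def flip: m_def scaleR_left.sum)
  from weighted_variance[OF p(2), of "\<lambda>i. U i - (E i - m)", unfolded this]
  have split: "(\<Sum>i\<in>A. p i * (norm (U i - (E i - m)))\<^sup>2)
      = (\<Sum>i\<in>A. p i * (norm (U i - D - (E i - m)))\<^sup>2) + (norm D)\<^sup>2"
    by (simp add: algebra_simps)
  have "(\<Sum>i\<in>A. p i * (norm (U i - D - (E i - m)))\<^sup>2) \<le> a + s * Q + (1 + s) * b"
  proof (cases "s = 0")
    case True
    have nonneg: "0 \<le> p i * (norm (U i - D))\<^sup>2" if "i \<in> A" for i
      using p(1)[OF that] by simp
    have "a \<le> 0" using var True by (simp add: a D_def)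
    moreover have "0 \<le> a" unfolding a_def by (rule sum_nonneg[OF nonneg])
    ultimately have a0: "a = 0" by simp
    then have "\<forall>i\<in>A. p i * (norm (U i - D))\<^sup>2 = 0"
      using sum_nonneg_eq_0_iff[OF fin nonneg] by (simp add: a_def)
    then have "(\<Sum>i\<in>A. p i * (norm (U i - D - (E i - m)))\<^sup>2) = b"
      unfolding b_def by (intro sum.cong) (auto simp: norm_minus_commute)
    with True a0 show ?thesis by simp
  next
    case False
    with s have pos: "s > 0" by simp
    have "(\<Sum>i\<in>A. p i * (norm (U i - D - (E i - m)))\<^sup>2)
        \<le> (\<Sum>i\<in>A. p i * ((1 + 1 / s) * (norm (U i - D))\<^sup>2 + (1 + s) * (norm (E i - m))\<^sup>2))"
      by (intro sum_mono mult_left_mono norm_diff_squared_young pos p(1))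
    also have "\<dots> = (1 + 1 / s) * a + (1 + s) * b"
      by (simp add: a_def b_def sum_distrib_left sum.distrib algebra_simps)
    also have "\<dots> \<le> a + s * Q + (1 + s) * b"
      using var pos by (simp add: a D_def field_simps power2_eq_square)
    finally show ?thesis .
  qed
  moreover have "(1 + s) * b \<le> (1 + s) * (\<Sum>i\<in>A. p i * (norm (E i))\<^sup>2)"
    using s by (intro mult_left_mono) (auto simp: b)
  ultimately show ?thesis
    unfolding split[unfolded m_def] using a by (simp add: m_def)
qed

section \<open>Contraction of a Lyapunov function\<close>

text \<open>The parameter \<open>K\<close> bounds the ratios \<open>L\<^sub>i / (n p\<^sub>i)\<close>, \<open>s\<close> stands for \<open>sqrt (1 - \<mu>/K)\<close>, \<open>pm\<close> is a lower bound on
the probabilities, and \<open>xs\<close> is the solution. The bound \<open>lam_le\<close> is what makes the primal and dual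
error terms proportional to \<open>\<langle>D, \<Delta>\<rangle>\<close> add up to no more than half of the decrease \<open>2 \<lambda> \<langle>D, \<Delta>\<rangle>\<close>.\<close>

locale contractive_saga =
  fixes n :: nat and g :: "'a::euclidean_space \<Rightarrow> ereal" and f :: "nat \<Rightarrow> 'a \<Rightarrow> real"
    and Li p :: "nat \<Rightarrow> real" and L \<mu> lam K s pm :: real and xs :: 'a
  assumes problem: "problem_properties n g f Li L \<mu>"
    and p_pos: "\<And>i. i \<in> {1..n} \<Longrightarrow> 0 < p i" and p_sum: "(\<Sum>i=1..n. p i) = 1"
    and pm_le: "\<And>i. i \<in> {1..n} \<Longrightarrow> pm \<le> p i"
    and Li_le: "\<And>i. i \<in> {1..n} \<Longrightarrow> Li i \<le> real n * p i * K"
    and s_nonneg: "0 \<le> s" and s_eq: "K * s\<^sup>2 = K - \<mu>"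
    and lam_pos: "0 < lam" and lam_less: "\<mu> * lam < pm"
    and lam_le: "lam * (K * (1 + s) * (1 + pm / (pm - \<mu> * lam))) \<le> 1"
    and xs: "is_solution n g f xs"
begin

abbreviation "gf i x \<equiv> grad (f i) x"
abbreviation "F \<equiv> avg n f"
abbreviation "\<rho> \<equiv> \<mu> * lam"

text \<open>The weight \<open>\<gamma>\<^sub>i\<close> solves \<open>\<lambda>\<^sup>2 (1 + s) / (n\<^sup>2 p\<^sub>i) + (1 - p\<^sub>i) \<gamma>\<^sub>i = (1 - \<rho>) \<gamma>\<^sub>i\<close>: the variance caused by \<open>y\<^sub>i\<close>, plus
what stays of its own term when \<open>i\<close> is not drawn, is the target.\<close>

definition dual_weight :: "nat \<Rightarrow> real" where
  "dual_weight i = lam\<^sup>2 * (1 + s) / ((real n)\<^sup>2 * p i * (p i - \<rho>))"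

definition lyapunov :: "'a \<times> (nat \<Rightarrow> 'a) \<Rightarrow> real" where
  "lyapunov = (\<lambda>(x, y).
     (norm (x - xs))\<^sup>2 + (\<Sum>i=1..n. dual_weight i * (norm (y i - gf i xs))\<^sup>2))"

definition saga_step :: "'a \<times> (nat \<Rightarrow> 'a) \<Rightarrow> nat \<Rightarrow> 'a \<times> (nat \<Rightarrow> 'a)" where
  "saga_step = (\<lambda>(x, y) j.
     (prox lam g (x - (lam / real n) *\<^sub>R ((1 / p j) *\<^sub>R (gf j x - y j) + (\<Sum>i=1..n. y i))),
      y(j := gf j x)))"

lemma saga_Suc:
  "saga n g f p lam x0 y0 r (Suc k) = saga_step (saga n g f p lam x0 y0 r k) (r k)"
  by (simp add: saga_step_def Let_def split: prod.split)

lemma n_pos: "0 < n" and g: "closed_convex_proper g" and F_sc: "strongly_convex \<mu> F"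
  and mu_pos: "0 < \<mu>"
  using problem by (auto simp: problem_properties_def strongly_convex_def)

lemma f_smooth: "i \<in> {1..n} \<Longrightarrow> smooth (Li i) (f i)"
  using problem by (auto simp: problem_properties_def)

lemma K_pos: "0 < K"
proof -
  have 1: "1 \<in> {1..n}" using n_pos by auto
  then have "0 < Li 1" using f_smooth by (auto simp: smooth_def)
  with Li_le[OF 1] have "0 < (real n * p 1) * K" by linarith
  moreover have "0 < real n * p 1" using n_pos p_pos[OF 1] by simp
  ultimately show ?thesis by (rule zero_less_mult_pos)
qed

lemma GDERIV_F: "GDERIV F x :> grad F x"
  using problem by (intro GDERIV_grad) (auto simp: problem_properties_def smooth_def)

lemma grad_F: "grad F x = (1 / real n) *\<^sub>R (\<Sum>i=1..n. gf i x)"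
  using f_smooth by (intro grad_eqI GDERIV_avg) (auto simp: smooth_def)

lemma p_minus_rho_pos: "i \<in> {1..n} \<Longrightarrow> 0 < p i - \<rho>"
  using pm_le lam_less by fastforce

lemma rho_le_1: "\<rho> \<le> 1"
proof -
  have 1: "1 \<in> {1..n}" using n_pos by auto
  have "p 1 \<le> (\<Sum>i=1..n. p i)"
    using 1 p_pos by (intro member_le_sum) (auto intro: less_imp_le)
  with p_minus_rho_pos[OF 1] p_sum show ?thesis by linarith
qed

lemma dual_weight_nonneg: "i \<in> {1..n} \<Longrightarrow> 0 \<le> dual_weight i"
  using p_pos[of i] p_minus_rho_pos[of i] s_nonneg by (simp add: dual_weight_def)

lemma norm_le_lyapunov: "(norm (fst z - xs))\<^sup>2 \<le> lyapunov z"
  unfolding lyapunov_def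
  by (auto simp: split_beta intro!: sum_nonneg mult_nonneg_nonneg dual_weight_nonneg)

text \<open>The terms in \<open>e\<close> balance by the choice of the dual weights. All terms in \<open>d\<close> and \<open>D\<close> are reduced to
multiples of \<open>q = \<langle>D, \<Delta>\<rangle>\<close>, and only what is left of \<open>- 2 \<lambda> q\<close> in the end is traded for \<open>\<parallel>\<Delta>\<parallel>\<^sup>2\<close> by strong
convexity.\<close>

lemma expected_lyapunov_step:
  "(\<Sum>i=1..n. p i * lyapunov (saga_step z i)) \<le> (1 - \<rho>) * lyapunov z"
proof -
  obtain x y where z: "z = (x, y)" by (cases z)
  let ?A = "{1..n}"
  define \<Delta> where "\<Delta> = x - xs"
  define d where "d i = gf i x - gf i xs" for i
  define e where "e i = y i - gf i xs" for i
  define U where "U i = (1 / (real n * p i)) *\<^sub>R d i" for i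
  define E where "E i = (1 / (real n * p i)) *\<^sub>R e i" for i
  define m where "m = (\<Sum>i\<in>?A. p i *\<^sub>R E i)"
  define D where "D = (\<Sum>i\<in>?A. p i *\<^sub>R U i)"
  define W where "W i = U i - (E i - m)" for i
  define q where "q = D \<bullet> \<Delta>"
  define a where "a = pm / (pm - \<rho>)"
  define u where "u = (\<Sum>i\<in>?A. p i * (norm (U i))\<^sup>2)"
  have n0: "real n > 0" using n_pos by simp
  have pU: "p i *\<^sub>R U i = (1 / real n) *\<^sub>R d i" and pE: "p i *\<^sub>R E i = (1 / real n) *\<^sub>R e i"
    if "i \<in> ?A" for i
    using p_pos[OF that] n0 by (simp_all add: U_def E_def)
  have D_eq: "D = (1 / real n) *\<^sub>R (\<Sum>i\<in>?A. d i)"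
    unfolding D_def scaleR_sum_right by (intro sum.cong refl pU)
  have m_eq: "m = (1 / real n) *\<^sub>R (\<Sum>i\<in>?A. e i)"
    unfolding m_def scaleR_sum_right by (intro sum.cong refl pE)
  have D_grad: "D = grad F x - grad F xs"
    by (simp add: D_eq grad_F d_def sum_subtractf scaleR_diff_right)
  have strong: "\<mu> * (norm \<Delta>)\<^sup>2 \<le> q"
    using strongly_convex_gradient_monotone[OF F_sc GDERIV_F GDERIV_F, of x xs]
    by (simp add: q_def D_grad \<Delta>_def inner_commute)
  have q_nonneg: "0 \<le> q"
    using strong mu_pos by (meson dual_order.trans less_imp_le mult_nonneg_nonneg zero_le_power2)
  \<comment> \<open>\<open>\<parallel>D\<parallel>\<^sup>2 - \<mu> q = \<parallel>D - \<mu> \<Delta>\<parallel>\<^sup>2 + \<mu> (q - \<mu> \<parallel>\<Delta>\<parallel>\<^sup>2)\<close>, a sum of nonnegative terms.\<close>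
  have D_ge: "\<mu> * q \<le> (norm D)\<^sup>2"
  proof -
    have "0 \<le> (norm (D - \<mu> *\<^sub>R \<Delta>))\<^sup>2 + \<mu> * (q - \<mu> * (norm \<Delta>)\<^sup>2)"
      using strong mu_pos by simp
    also have "\<dots> = (norm D)\<^sup>2 - \<mu> * q"
      by (simp add: q_def power2_norm_eq_inner inner_commute algebra_simps)
    finally show ?thesis by simp
  qed
  have U_le: "p i * (norm (U i))\<^sup>2 \<le> K * ((p i *\<^sub>R U i) \<bullet> \<Delta>)" if i: "i \<in> ?A" for i
  proof -
    have c: "(norm (d i))\<^sup>2 \<le> Li i * (d i \<bullet> \<Delta>)"
      unfolding d_def \<Delta>_def by (rule smooth_cocoercive[OF f_smooth[OF i]])
    have "0 < Li i" using f_smooth[OF i] by (simp add: smooth_def)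
    with c have "0 \<le> d i \<bullet> \<Delta>"
      by (meson order_trans zero_le_power2 zero_le_mult_iff not_le)
    with c Li_le[OF i] have "(norm (d i))\<^sup>2 \<le> real n * p i * K * (d i \<bullet> \<Delta>)"
      by (meson mult_right_mono order_trans)
    then show ?thesis
      using p_pos[OF i] n0
      by (simp add: U_def power_mult_distrib power_divide field_simps power2_eq_square)
  qed
  have u_le: "u \<le> K * q"
    unfolding u_def q_def D_def inner_sum_left sum_distrib_left by (rule sum_mono[OF U_le])
  have second_moment: "(\<Sum>i\<in>?A. p i * (norm (W i))\<^sup>2)
      \<le> u + s * (K * q) + (1 + s) * (\<Sum>i\<in>?A. p i * (norm (E i))\<^sup>2)"
    unfolding W_def m_def u_def
  proof (rule variance_reduced_second_moment)
    have "u - (norm D)\<^sup>2 \<le> (K - \<mu>) * q"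
      using u_le D_ge by (simp add: algebra_simps)
    then show "(\<Sum>i\<in>?A. p i * (norm (U i))\<^sup>2) - (norm (\<Sum>i\<in>?A. p i *\<^sub>R U i))\<^sup>2 \<le> s\<^sup>2 * (K * q)"
      by (simp add: u_def D_def algebra_simps flip: s_eq)
  qed (use p_pos p_sum s_nonneg in \<open>auto intro: less_imp_le\<close>)
  have sub: "subgradient g xs (- grad F xs)"
    using xs unfolding is_solution_def by (rule minimizer_subgradient[OF g GDERIV_F])
  \<comment> \<open>\<open>x\<^sup>*\<close> is a fixed point of the exact step: it is the proximal point of \<open>x\<^sup>* - \<lambda> \<nabla>F(x\<^sup>*)\<close>. The estimate
    of \<open>\<nabla>F(x)\<close> differs from \<open>\<nabla>F(x\<^sup>*)\<close> by \<open>W i\<close>, which has mean \<open>D\<close>.\<close>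
  have primal: "(norm (fst (saga_step z i) - xs))\<^sup>2 \<le> (norm (\<Delta> - lam *\<^sub>R W i))\<^sup>2"
    if i: "i \<in> ?A" for i
  proof -
    let ?z = "x - (lam / real n) *\<^sub>R ((1 / p i) *\<^sub>R (gf i x - y i) + (\<Sum>i=1..n. y i))"
    have "(\<Sum>i\<in>?A. y i) = real n *\<^sub>R (m + grad F xs)"
      using n0 by (simp add: m_eq grad_F e_def sum_subtractf flip: scaleR_add_right)
    moreover have "(1 / p i) *\<^sub>R (gf i x - y i) = real n *\<^sub>R (U i - E i)"
      using n0 by (simp add: U_def E_def d_def e_def scaleR_diff_right)
    ultimately have "?z = x - (lam / real n) *\<^sub>R
        (real n *\<^sub>R (U i - E i) + real n *\<^sub>R (m + grad F xs))"
      by (simp only:)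
    also have "\<dots> = x - lam *\<^sub>R (U i - E i + (m + grad F xs))"
      using n0 by (simp flip: scaleR_add_right)
    finally have "?z - (xs + lam *\<^sub>R (- grad F xs)) = \<Delta> - lam *\<^sub>R W i"
      by (simp add: W_def \<Delta>_def algebra_simps)
    with prox_contracts_to_subgradient_point[OF g lam_pos sub, of ?z]
    show ?thesis
      by (simp add: z saga_step_def power_mono)
  qed
  have "(\<Sum>i\<in>?A. p i *\<^sub>R W i) = D - (m - (\<Sum>i\<in>?A. p i) *\<^sub>R m)"
    unfolding W_def D_def m_def scaleR_diff_right sum_subtractf scaleR_sum_left ..
  then have "(\<Sum>i\<in>?A. p i *\<^sub>R W i) = D" by (simp only: p_sum) simp
  then have WD: "(\<Sum>i\<in>?A. p i * (\<Delta> \<bullet> W i)) = q"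
    by (simp add: q_def inner_commute flip: inner_sum_right inner_scaleR_right)
  have "p i * (norm (\<Delta> - lam *\<^sub>R W i))\<^sup>2
      = p i * (norm \<Delta>)\<^sup>2 - 2 * lam * (p i * (\<Delta> \<bullet> W i)) + lam\<^sup>2 * (p i * (norm (W i))\<^sup>2)" for i
    unfolding power2_norm_eq_inner by (simp add: inner_commute power2_eq_square algebra_simps)
  then have "(\<Sum>i\<in>?A. p i * (norm (\<Delta> - lam *\<^sub>R W i))\<^sup>2)
      = (norm \<Delta>)\<^sup>2 - 2 * lam * q + lam\<^sup>2 * (\<Sum>i\<in>?A. p i * (norm (W i))\<^sup>2)"
    using WD p_sum
    by (simp add: sum.distrib sum_subtractf flip: sum_distrib_left sum_distrib_right)
  moreover have "(\<Sum>i\<in>?A. p i * (norm (fst (saga_step z i) - xs))\<^sup>2)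
      \<le> (\<Sum>i\<in>?A. p i * (norm (\<Delta> - lam *\<^sub>R W i))\<^sup>2)"
    using p_pos by (intro sum_mono mult_left_mono primal) (auto intro: less_imp_le)
  moreover have "lam\<^sup>2 * (\<Sum>i\<in>?A. p i * (norm (W i))\<^sup>2)
      \<le> lam\<^sup>2 * (u + s * (K * q) + (1 + s) * (\<Sum>i\<in>?A. p i * (norm (E i))\<^sup>2))"
    by (intro mult_left_mono second_moment) simp
  ultimately have primal_sum: "(\<Sum>i\<in>?A. p i * (norm (fst (saga_step z i) - xs))\<^sup>2)
      \<le> (norm \<Delta>)\<^sup>2 - 2 * lam * q
        + lam\<^sup>2 * (u + s * (K * q) + (1 + s) * (\<Sum>i\<in>?A. p i * (norm (E i))\<^sup>2))"
    by linarith
  define dual where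
    "dual i = (\<Sum>j\<in>?A. dual_weight j * (norm (snd (saga_step z i) j - gf j xs))\<^sup>2)" for i
  have dual_eq: "dual i = (\<Sum>j\<in>?A. dual_weight j * (norm (e j))\<^sup>2)
      + dual_weight i * ((norm (d i))\<^sup>2 - (norm (e i))\<^sup>2)" if i: "i \<in> ?A" for i
  proof -
    have "dual i = (\<Sum>j\<in>?A. dual_weight j * (norm (e j))\<^sup>2
        + (if j = i then dual_weight i * ((norm (d i))\<^sup>2 - (norm (e i))\<^sup>2) else 0))"
      unfolding dual_def
      by (intro sum.cong) (auto simp: z saga_step_def d_def e_def algebra_simps)
    with i show ?thesis by (simp add: sum.distrib)
  qed
  have "(\<Sum>i\<in>?A. p i * dual i)
      = (\<Sum>i\<in>?A. p i * (\<Sum>j\<in>?A. dual_weight j * (norm (e j))\<^sup>2)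
          + p i * dual_weight i * ((norm (d i))\<^sup>2 - (norm (e i))\<^sup>2))"
    by (intro sum.cong refl) (simp only: dual_eq distrib_left mult.assoc)
  also have "\<dots> = (\<Sum>j\<in>?A. dual_weight j * (norm (e j))\<^sup>2)
      + (\<Sum>i\<in>?A. p i * dual_weight i * ((norm (d i))\<^sup>2 - (norm (e i))\<^sup>2))"
    using p_sum by (simp add: sum.distrib flip: sum_distrib_right)
  finally have dual_sum: "(\<Sum>i\<in>?A. p i * dual i)
      = (\<Sum>i\<in>?A. dual_weight i * p i * (norm (d i))\<^sup>2)
        + (\<Sum>i\<in>?A. dual_weight i * (1 - p i) * (norm (e i))\<^sup>2)"
    by (simp add: algebra_simps sum.distrib sum_subtractf)
  \<comment> \<open>The dual terms that depend on \<open>x\<close> cost a multiple of the second moment of \<open>U\<close>, as \<open>t / (t - \<rho>)\<close>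
    decreases with \<open>t\<close>.\<close>
  have d_part: "(\<Sum>i\<in>?A. dual_weight i * p i * (norm (d i))\<^sup>2) \<le> lam\<^sup>2 * (1 + s) * a * u"
    unfolding u_def sum_distrib_left
  proof (rule sum_mono)
    fix i assume i: "i \<in> ?A"
    have "p i * (pm - \<rho>) \<le> pm * (p i - \<rho>)"
      using mult_right_mono[OF pm_le[OF i], of \<rho>] mu_pos lam_pos by (simp add: algebra_simps)
    then have "p i / (p i - \<rho>) \<le> a"
      using p_minus_rho_pos[OF i] lam_less by (simp add: a_def divide_simps)
    then have "lam\<^sup>2 * (1 + s) * (p i * (norm (U i))\<^sup>2) * (p i / (p i - \<rho>))
        \<le> lam\<^sup>2 * (1 + s) * (p i * (norm (U i))\<^sup>2) * a"
      using p_pos[OF i] s_nonneg by (intro mult_left_mono) auto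
    moreover have "dual_weight i * p i * (norm (d i))\<^sup>2
        = lam\<^sup>2 * (1 + s) * (p i * (norm (U i))\<^sup>2) * (p i / (p i - \<rho>))"
      using p_pos[OF i] p_minus_rho_pos[OF i] n0
      by (simp add: dual_weight_def U_def power2_eq_square)
    ultimately show "dual_weight i * p i * (norm (d i))\<^sup>2
        \<le> lam\<^sup>2 * (1 + s) * a * (p i * (norm (U i))\<^sup>2)"
      by (simp add: mult_ac)
  qed
  have e_part: "lam\<^sup>2 * (1 + s) * (\<Sum>i\<in>?A. p i * (norm (E i))\<^sup>2)
        + (\<Sum>i\<in>?A. dual_weight i * (1 - p i) * (norm (e i))\<^sup>2)
      = (1 - \<rho>) * (\<Sum>i\<in>?A. dual_weight i * (norm (e i))\<^sup>2)"
    unfolding sum_distrib_left sum.distrib[symmetric]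
  proof (rule sum.cong)
    fix i assume i: "i \<in> ?A"
    have "lam\<^sup>2 * (1 + s) * (p i * (norm (E i))\<^sup>2)
        = dual_weight i * (p i - \<rho>) * (norm (e i))\<^sup>2"
      using p_pos[OF i] p_minus_rho_pos[OF i] n0
      by (simp add: dual_weight_def E_def power2_eq_square)
    then show "lam\<^sup>2 * (1 + s) * (p i * (norm (E i))\<^sup>2)
          + dual_weight i * (1 - p i) * (norm (e i))\<^sup>2
        = (1 - \<rho>) * (dual_weight i * (norm (e i))\<^sup>2)"
      by (simp add: algebra_simps)
  qed simp
  have "0 < \<rho>" using mu_pos lam_pos by simp
  with lam_less have "0 \<le> a" by (simp add: a_def)
  then have "lam\<^sup>2 * (1 + (1 + s) * a) * u \<le> lam\<^sup>2 * (1 + (1 + s) * a) * (K * q)"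
    using s_nonneg by (intro mult_left_mono u_le) auto
  moreover have "lam * (K * (1 + s) * (1 + a)) * (lam * q) \<le> 1 * (lam * q)"
    using lam_le lam_pos q_nonneg by (intro mult_right_mono) (auto simp: a_def)
  ultimately have "lam\<^sup>2 * (u + s * (K * q)) + lam\<^sup>2 * (1 + s) * a * u \<le> lam * q"
    by (simp add: algebra_simps power2_eq_square)
  moreover have "lam * (\<mu> * (norm \<Delta>)\<^sup>2) \<le> lam * q"
    using strong lam_pos by (intro mult_left_mono) auto
  ultimately have "(\<Sum>i\<in>?A. p i * (norm (fst (saga_step z i) - xs))\<^sup>2) + (\<Sum>i\<in>?A. p i * dual i)
      \<le> (1 - \<rho>) * (norm \<Delta>)\<^sup>2 + (1 - \<rho>) * (\<Sum>i\<in>?A. dual_weight i * (norm (e i))\<^sup>2)"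
    using primal_sum dual_sum d_part e_part by (simp add: algebra_simps)
  moreover have "lyapunov (saga_step z i) = (norm (fst (saga_step z i) - xs))\<^sup>2 + dual i" for i
    by (simp add: lyapunov_def dual_def split_beta)
  moreover have "lyapunov z = (norm \<Delta>)\<^sup>2 + (\<Sum>i\<in>?A. dual_weight i * (norm (e i))\<^sup>2)"
    by (simp add: lyapunov_def z \<Delta>_def e_def)
  ultimately show ?thesis
    by (simp add: distrib_left sum.distrib)
qed

end

section \<open>Averaging over the random indices\<close>

text \<open>A function of the first \<open>k\<close> indices factors through a finite discrete space, so it is bounded and measurable.\<close>

lemma iid_sampling_integrable:
  fixes h :: "(nat \<Rightarrow> nat) \<Rightarrow> real"
  assumes I: "iid_sampling M n p I" and past: "\<And>r r'. (\<And>j. j < k \<Longrightarrow> r j = r' j) \<Longrightarrow> h r = h r'"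
  shows "integrable M (\<lambda>\<omega>. h (\<lambda>j. I j \<omega>))"
proof -
  interpret prob_space M using I by (simp add: iid_sampling_def)
  have meas: "I j \<in> measurable M (count_space {1..n})" for j
    using I by (simp add: iid_sampling_def indep_vars_def)
  define X where "X \<omega> = restrict (\<lambda>j. I j \<omega>) {..<k}" for \<omega>
  have "X \<in> measurable M (PiM {..<k} (\<lambda>_. count_space {1..n}))"
    unfolding X_def by (intro measurable_restrict meas)
  then have X: "X \<in> measurable M (count_space (PiE {..<k} (\<lambda>_. {1..n})))"
    by (simp add: count_space_PiM_finite)
  have hX: "h (\<lambda>j. I j \<omega>) = h (X \<omega>)" for \<omega>
    by (rule past) (simp add: X_def)
  have fin: "finite (PiE {..<k} (\<lambda>_. {1..n}))"
    by (intro finite_PiE) auto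
  show ?thesis
    unfolding hX
  proof (rule integrable_const_bound)
    show "AE \<omega> in M. norm (h (X \<omega>)) \<le> Max ((\<lambda>r. norm (h r)) ` PiE {..<k} (\<lambda>_. {1..n}))"
      using measurable_space[OF X] fin by (intro AE_I2 Max_ge) auto
    show "(\<lambda>\<omega>. h (X \<omega>)) \<in> borel_measurable M"
      by (rule measurable_compose[OF X]) simp
  qed
qed

text \<open>Independence of the index \<open>I k\<close> from the earlier ones, in the form in which it replaces a conditional
expectation: the latest index may be averaged out first.\<close>

lemma iid_sampling_expectation_next:
  fixes h :: "(nat \<Rightarrow> nat) \<Rightarrow> nat \<Rightarrow> real"
  assumes I: "iid_sampling M n p I"
    and past: "\<And>r r' i. (\<And>j. j < k \<Longrightarrow> r j = r' j) \<Longrightarrow> h r i = h r' i"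
  shows "integral\<^sup>L M (\<lambda>\<omega>. h (\<lambda>j. I j \<omega>) (I k \<omega>))
    = (\<Sum>i=1..n. p i * integral\<^sup>L M (\<lambda>\<omega>. h (\<lambda>j. I j \<omega>) i))"
proof -
  interpret prob_space M using I by (simp add: iid_sampling_def)
  have indep: "indep_vars (\<lambda>_. count_space {1..n}) I UNIV"
    and pk: "\<And>i. i \<in> {1..n} \<Longrightarrow> measure M {\<omega> \<in> space M. I k \<omega> = i} = p i"
    using I by (simp_all add: iid_sampling_def)
  have meas: "I j \<in> measurable M (count_space {1..n})" for j
    using indep by (simp add: indep_vars_def)
  have int: "integrable M (\<lambda>\<omega>. h (\<lambda>j. I j \<omega>) i)" for i
    by (rule iid_sampling_integrable[OF I, where h = "\<lambda>r. h r i" and k = k]) (rule past)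
  have ev: "{\<omega> \<in> space M. I k \<omega> = i} \<in> sets M" if "i \<in> {1..n}" for i
    using measurable_sets[OF meas[of k], of "{i}"] that
    by (simp add: vimage_def Int_def conj_commute)
  define J where "J i \<omega> = (indicator {i} (I k \<omega>) :: real)" for i \<omega>
  have J_int: "integrable M (J i)" and J_exp: "integral\<^sup>L M (J i) = p i" if i: "i \<in> {1..n}" for i
  proof -
    let ?B = "{\<omega> \<in> space M. I k \<omega> = i}"
    have J: "J i \<omega> = indicator ?B \<omega>" if "\<omega> \<in> space M" for \<omega>
      using that by (simp add: J_def indicator_def)
    have "integrable M (indicator ?B :: _ \<Rightarrow> real)"
      using ev[OF i] by (intro integrable_real_indicator) (simp_all add: less_top[symmetric])
    then show "integrable M (J i)"
      by (simp cong: Bochner_Integration.integrable_cong add: J)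
    show "integral\<^sup>L M (J i) = p i"
      using ev[OF i] pk[OF i] by (simp cong: Bochner_Integration.integral_cong add: J)
  qed
  have JX: "integrable M (\<lambda>\<omega>. J i \<omega> * h (\<lambda>j. I j \<omega>) i)"
    "integral\<^sup>L M (\<lambda>\<omega>. J i \<omega> * h (\<lambda>j. I j \<omega>) i) = p i * integral\<^sup>L M (\<lambda>\<omega>. h (\<lambda>j. I j \<omega>) i)"
    if i: "i \<in> {1..n}" for i
  proof -
    let ?M = "\<lambda>A. PiM A (\<lambda>_. count_space {1..n})"
    have "indep_var (?M {k}) (\<lambda>\<omega>. restrict (\<lambda>j. I j \<omega>) {k}) (?M {..<k}) (\<lambda>\<omega>. restrict (\<lambda>j. I j \<omega>) {..<k})"
      using indep by (rule indep_var_restrict) auto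
    then have "indep_var borel ((\<lambda>r. indicator {i} (r k) :: real) \<circ> (\<lambda>\<omega>. restrict (\<lambda>j. I j \<omega>) {k}))
        borel ((\<lambda>r. h r i) \<circ> (\<lambda>\<omega>. restrict (\<lambda>j. I j \<omega>) {..<k}))"
      by (rule indep_var_compose) (simp_all add: count_space_PiM_finite)
    moreover have "h (restrict (\<lambda>j. I j \<omega>) {..<k}) i = h (\<lambda>j. I j \<omega>) i" for \<omega>
      by (rule past) simp
    ultimately have "indep_var borel (J i) borel (\<lambda>\<omega>. h (\<lambda>j. I j \<omega>) i)"
      by (simp add: o_def J_def[abs_def])
    from indep_var_lebesgue_integral[OF this J_int[OF i] int]
      indep_var_integrable[OF this J_int[OF i] int]
    show "integrable M (\<lambda>\<omega>. J i \<omega> * h (\<lambda>j. I j \<omega>) i)"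
      "integral\<^sup>L M (\<lambda>\<omega>. J i \<omega> * h (\<lambda>j. I j \<omega>) i) = p i * integral\<^sup>L M (\<lambda>\<omega>. h (\<lambda>j. I j \<omega>) i)"
      by (simp_all add: J_exp[OF i])
  qed
  have "integral\<^sup>L M (\<lambda>\<omega>. h (\<lambda>j. I j \<omega>) (I k \<omega>))
      = integral\<^sup>L M (\<lambda>\<omega>. \<Sum>i=1..n. J i \<omega> * h (\<lambda>j. I j \<omega>) i)"
  proof (rule Bochner_Integration.integral_cong)
    fix \<omega> assume "\<omega> \<in> space M"
    then have "I k \<omega> \<in> {1..n}" using measurable_space[OF meas] by fastforce
    then show "h (\<lambda>j. I j \<omega>) (I k \<omega>) = (\<Sum>i=1..n. J i \<omega> * h (\<lambda>j. I j \<omega>) i)"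
      by (simp add: J_def indicator_def if_distrib[of "\<lambda>c. c * _"] cong: if_cong)
  qed simp
  also have "\<dots> = (\<Sum>i=1..n. p i * integral\<^sup>L M (\<lambda>\<omega>. h (\<lambda>j. I j \<omega>) i))"
    using JX by (subst Bochner_Integration.integral_sum) auto
  finally show ?thesis .
qed

lemma iid_sampling_sum_eq_1:
  assumes "iid_sampling M n p I"
  shows "(\<Sum>i=1..n. p i) = 1"
  using iid_sampling_expectation_next[OF assms, of 0 "\<lambda>_ _. 1"] assms
  by (simp add: iid_sampling_def prob_space.prob_space)

lemma saga_depends_on_past:
  "(\<And>j. j < k \<Longrightarrow> r j = r' j) \<Longrightarrow> saga n g f p lam x0 y0 r k = saga n g f p lam x0 y0 r' k"
proof (induction k)
  case (Suc k)
  then have "saga n g f p lam x0 y0 r k = saga n g f p lam x0 y0 r' k" "r k = r' k"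
    by auto
  then show ?case by (simp only: saga.simps)
qed simp

context contractive_saga
begin

text \<open>The constant in the rate is the initial value of the Lyapunov function.\<close>

lemma saga_linear_convergence:
  assumes I: "iid_sampling M n p I"
  shows "(\<lambda>k. integral\<^sup>L M (\<lambda>\<omega>. (norm (saga_x n g f p lam x0 y0 I k \<omega> - xs))\<^sup>2))
    \<in> O(\<lambda>k. (1 - \<rho>) ^ k)"
proof -
  interpret prob_space M using I by (simp add: iid_sampling_def)
  define S where "S r k = saga n g f p lam x0 y0 r k" for r k
  have int: "integrable M (\<lambda>\<omega>. \<phi> (S (\<lambda>j. I j \<omega>) k))" for \<phi> :: "_ \<Rightarrow> real" and k
    unfolding S_def
    by (rule iid_sampling_integrable[OF I, where h = "\<lambda>r. \<phi> (saga n g f p lam x0 y0 r k)" and k = k],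
        rule arg_cong[of _ _ \<phi>], rule saga_depends_on_past)
  note int_lyapunov = int[of lyapunov] and int_step = int[of "\<lambda>z. lyapunov (saga_step z i)" for i]
    and int_dist = int[of "\<lambda>z. (norm (fst z - xs))\<^sup>2"]
  have past: "lyapunov (saga_step (S r k) i) = lyapunov (saga_step (S r' k) i)"
    if "\<And>j. j < k \<Longrightarrow> r j = r' j" for r r' k i
    unfolding S_def by (subst saga_depends_on_past[of k r r', OF that]) auto
  have decay: "expectation (\<lambda>\<omega>. lyapunov (S (\<lambda>j. I j \<omega>) k)) \<le> (1 - \<rho>) ^ k * lyapunov (x0, y0)" for k
  proof (induction k)
    case 0
    show ?case by (simp add: S_def prob_space)
  next
    case (Suc k)
    have "expectation (\<lambda>\<omega>. lyapunov (S (\<lambda>j. I j \<omega>) (Suc k)))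
        = expectation (\<lambda>\<omega>. lyapunov (saga_step (S (\<lambda>j. I j \<omega>) k) (I k \<omega>)))"
      by (simp only: S_def saga_Suc)
    also have "\<dots> = (\<Sum>i=1..n. p i * expectation (\<lambda>\<omega>. lyapunov (saga_step (S (\<lambda>j. I j \<omega>) k) i)))"
      by (rule iid_sampling_expectation_next[OF I,
            where h = "\<lambda>r i. lyapunov (saga_step (S r k) i)" and k = k]) (rule past)
    also have "\<dots> = expectation (\<lambda>\<omega>. \<Sum>i=1..n. p i * lyapunov (saga_step (S (\<lambda>j. I j \<omega>) k) i))"
      using int_step by (subst Bochner_Integration.integral_sum) simp_all
    also have "\<dots> \<le> expectation (\<lambda>\<omega>. (1 - \<rho>) * lyapunov (S (\<lambda>j. I j \<omega>) k))"
      using int_step int_lyapunov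
      by (intro integral_mono expected_lyapunov_step Bochner_Integration.integrable_sum) simp_all
    also have "\<dots> \<le> (1 - \<rho>) * ((1 - \<rho>) ^ k * lyapunov (x0, y0))"
      using rho_le_1 Suc.IH by (simp add: mult_left_mono)
    finally show ?case by (simp add: mult_ac)
  qed
  show ?thesis
  proof (rule bigoI[where c = "lyapunov (x0, y0)"], rule always_eventually, rule allI)
    fix k
    have "expectation (\<lambda>\<omega>. (norm (saga_x n g f p lam x0 y0 I k \<omega> - xs))\<^sup>2)
        \<le> expectation (\<lambda>\<omega>. lyapunov (S (\<lambda>j. I j \<omega>) k))"
      unfolding saga_x_def S_def[symmetric] 
      by (intro integral_mono norm_le_lyapunov int_dist int_lyapunov)
    also note decay[of k]
    finally show "norm (expectation (\<lambda>\<omega>. (norm (saga_x n g f p lam x0 y0 I k \<omega> - xs))\<^sup>2))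
        \<le> lyapunov (x0, y0) * norm ((1 - \<rho>) ^ k)"
      using rho_le_1 by (simp add: power_abs mult_ac)
  qed
qed

end

section \<open>Step-sizes\<close>

lemma MAX_eq_at:
  fixes h :: "'i \<Rightarrow> 'b::linorder"
  assumes "finite A" "i0 \<in> A" "\<And>i. i \<in> A \<Longrightarrow> h i \<le> h i0"
  shows "(MAX i\<in>A. h i) = h i0"
  using assms by (intro Max_eqI) auto

lemma MIN_eq_at:
  fixes h :: "'i \<Rightarrow> 'b::linorder"
  assumes "finite A" "i0 \<in> A" "\<And>i. i \<in> A \<Longrightarrow> h i0 \<le> h i"
  shows "(MIN i\<in>A. h i) = h i0"
  using assms by (intro Min_eqI) auto

text \<open>The minimum over \<open>\<delta>\<close> is attained where both \<open>\<delta>\<close>-dependent terms are equal, at \<open>\<delta> = sqrt (A / B)\<close>.\<close>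

lemma least_young_value:
  fixes A B c :: real
  assumes A: "A > 0" and B: "B > 0"
  shows "(LEAST v. \<exists>\<delta>>0. v = c + A * inverse \<delta> + B * \<delta>) = c + 2 * sqrt (A * B)"
proof (rule Least_equality)
  have "A * inverse (sqrt (A / B)) + B * sqrt (A / B) = 2 * sqrt (A * B)"
    using A B by (simp add: real_sqrt_divide real_sqrt_mult field_simps)
  then show "\<exists>\<delta>>0. c + 2 * sqrt (A * B) = c + A * inverse \<delta> + B * \<delta>"
    using A B by (intro exI[of _ "sqrt (A / B)"]) simp
next
  fix v assume "\<exists>\<delta>>0. v = c + A * inverse \<delta> + B * \<delta>"
  then obtain \<delta> where d: "\<delta> > 0" and v: "v = c + A * inverse \<delta> + B * \<delta>" by blast
  have "sqrt ((A * inverse \<delta>) * (B * \<delta>)) \<le> (A * inverse \<delta> + B * \<delta>) / 2"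
    using A B d by (intro arith_geo_mean_sqrt) auto
  moreover have "(A * inverse \<delta>) * (B * \<delta>) = A * B" using d by simp
  ultimately show "c + 2 * sqrt (A * B) \<le> v" by (simp add: v)
qed

text \<open>Both \<open>L\<^sub>i / (n p\<^sub>i)\<close> and \<open>p\<^sub>i / (p\<^sub>i - \<rho>)\<close> are largest at \<open>i0\<close>, hence so is the bracket for every \<open>\<delta>\<close>. The formula
also covers the degenerate branch \<open>K = \<mu>\<close>, where the square root vanishes.\<close>

lemma nu_closed_form:
  assumes i0: "i0 \<in> {1..n}" and K: "K = Li i0 / (real n * p i0)"
    and K_max: "\<And>i. i \<in> {1..n} \<Longrightarrow> Li i / (real n * p i) \<le> K"
    and p_min: "\<And>i. i \<in> {1..n} \<Longrightarrow> p i0 \<le> p i"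
    and mu: "0 < \<mu>" "\<mu> \<le> K" and rho: "0 \<le> \<rho>" "\<rho> < p i0"
  defines "a \<equiv> p i0 / (p i0 - \<rho>)"
  shows "nu n Li \<mu> p p \<rho> = K * a + K + 2 * sqrt (K * a * (K - \<mu>))"
proof -
  have ratio: "p i / (p i - \<rho>) \<le> a" if "i \<in> {1..n}" for i
  proof -
    have "p i * (p i0 - \<rho>) \<le> p i0 * (p i - \<rho>)"
      using mult_right_mono[OF p_min[OF that] rho(1)] by (simp add: algebra_simps)
    then show ?thesis using rho p_min[OF that] by (simp add: a_def divide_simps)
  qed
  have ratio_nonneg: "0 \<le> p i / (p i - \<rho>)" if "i \<in> {1..n}" for i
    using rho p_min[OF that] by simp
  have a_pos: "0 < a" using rho by (simp add: a_def)
  have max_K: "(MAX i\<in>{1..n}. Li i / (real n * p i)) = K"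
    using MAX_eq_at[OF _ i0, of "\<lambda>i. Li i / (real n * p i)"] K K_max by simp
  show ?thesis
  proof (cases "K > \<mu>")
    case True
    have max: "(MAX i\<in>{1..n}. (1 + inverse \<delta>) * (Li i / (real n * p i)) * (p i / (p i - \<rho>))
          + (1 + \<delta>) * (Li i / (real n * p i)) - \<delta> * \<mu>)
        = (K * a + K) + (K * a) * inverse \<delta> + (K - \<mu>) * \<delta>" (is "(MAX i\<in>_. ?h i) = _")
      if d: "\<delta> > 0" for \<delta>
    proof -
      have h0: "?h i0 = (1 + inverse \<delta>) * K * a + (1 + \<delta>) * K - \<delta> * \<mu>"
        by (simp add: K a_def)
      have "?h i \<le> ?h i0" if i: "i \<in> {1..n}" for i
      proof -
        have "Li i / (real n * p i) * (p i / (p i - \<rho>)) \<le> K * a"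
          using K_max[OF i] ratio[OF i] ratio_nonneg[OF i] mu by (intro mult_mono) auto
        then have "(1 + inverse \<delta>) * (Li i / (real n * p i) * (p i / (p i - \<rho>)))
            \<le> (1 + inverse \<delta>) * (K * a)"
          using d by (intro mult_left_mono) auto
        moreover have "(1 + \<delta>) * (Li i / (real n * p i)) \<le> (1 + \<delta>) * K"
          using d K_max[OF i] by (intro mult_left_mono) auto
        ultimately show ?thesis unfolding h0 by (simp only: mult.assoc)
      qed
      then have "(MAX i\<in>{1..n}. ?h i) = ?h i0"
        by (rule MAX_eq_at[OF finite_atLeastAtMost i0])
      then show ?thesis unfolding h0 by (simp add: algebra_simps)
    qed
    have "nu n Li \<mu> p p \<rho>
        = (LEAST v. \<exists>\<delta>>0. v = (K * a + K) + (K * a) * inverse \<delta> + (K - \<mu>) * \<delta>)"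
      unfolding nu_def max_K if_P[OF True]
      by (intro arg_cong[where f = Least] ext arg_cong[where f = Ex] conj_cong refl)
         (simp only: max)
    also have "\<dots> = K * a + K + 2 * sqrt (K * a * (K - \<mu>))"
      using True mu a_pos by (intro least_young_value) auto
    finally show ?thesis .
  next
    case False
    then have "K = \<mu>" using mu by simp
    moreover have "(MAX i\<in>{1..n}. p i / (p i - \<rho>)) = a"
      using MAX_eq_at[OF _ i0, of "\<lambda>i. p i / (p i - \<rho>)"] ratio by (simp add: a_def)
    ultimately show ?thesis
      unfolding nu_def max_K using False by simp
  qed
qed

text \<open>The admissible step-sizes form the open interval from \<open>0\<close> to \<open>2 / (C K)\<close>. The upper end is
\<open>2 / \<nu>(0)\<close>, and \<open>\<nu>(\<rho>) \<ge> \<nu>(0)\<close> forbids larger ones. For \<open>\<lambda>\<close> inside, \<open>\<mu> \<lambda> (2 - \<nu>(\<rho>) \<lambda>) - \<rho>\<close> is positive at \<open>\<rho> = 0\<close> and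
negative near \<open>p i0\<close>, so it has a zero in between.\<close>

lemma max_step_size_closed_form:
  assumes i0: "i0 \<in> {1..n}" and K: "K = Li i0 / (real n * p i0)"
    and K_max: "\<And>i. i \<in> {1..n} \<Longrightarrow> Li i / (real n * p i) \<le> K"
    and p_min: "\<And>i. i \<in> {1..n} \<Longrightarrow> p i0 \<le> p i"
    and mu: "0 < \<mu>" "\<mu> \<le> K" and p_pos: "0 < p i0"
  shows "max_step_size n Li \<mu> p p = ereal (2 / ((2 + 2 * sqrt (1 - \<mu> / K)) * K))"
proof -
  define c where "c = (2 + 2 * sqrt (1 - \<mu> / K)) * K"
  define a where "a \<rho> = p i0 / (p i0 - \<rho>)" for \<rho>
  define \<nu> where "\<nu> \<rho> = K * a \<rho> + K + 2 * sqrt (K * a \<rho> * (K - \<mu>))" for \<rho>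
  have K_pos: "K > 0" using mu by linarith
  have c_pos: "c > 0" using K_pos mu by (simp add: c_def add_pos_nonneg)
  have min_p: "(MIN i\<in>{1..n}. p i) = p i0"
    by (rule MIN_eq_at[OF _ i0]) (auto simp: p_min)
  have nu: "nu n Li \<mu> p p \<rho> = \<nu> \<rho>" if "0 \<le> \<rho>" "\<rho> < p i0" for \<rho>
    using nu_closed_form[of i0 n K Li p \<mu> \<rho>, OF i0 K K_max p_min mu that] by (simp add: \<nu>_def a_def)
  have "K * sqrt (1 - \<mu> / K) = sqrt (K\<^sup>2 * (1 - \<mu> / K))"
    using K_pos by (simp add: real_sqrt_mult)
  also have "K\<^sup>2 * (1 - \<mu> / K) = K * (K - \<mu>)"
    using K_pos by (simp add: power2_eq_square field_simps)
  finally have c_eq: "c = K + K + 2 * sqrt (K * (K - \<mu>))"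
    by (simp add: c_def algebra_simps)
  have admissible: "(0 < lam \<and> (\<exists>\<rho>. 0 < \<rho> \<and> \<rho> < (MIN i\<in>{1..n}. p i) \<and>
      \<rho> = \<mu> * lam * (2 - nu n Li \<mu> p p \<rho> * lam))) \<longleftrightarrow> 0 < lam \<and> lam < 2 / c"
    (is "?l \<longleftrightarrow> ?r") for lam
  proof
    assume ?l
    then obtain \<rho> where lam: "0 < lam" and rho: "0 < \<rho>" "\<rho> < p i0"
      and eq: "\<rho> = \<mu> * lam * (2 - \<nu> \<rho> * lam)"
      unfolding min_p by (auto simp: nu)
    have "1 \<le> a \<rho>" using rho by (simp add: a_def)
    then have "K \<le> K * a \<rho>" using K_pos by simp
    moreover from this have "sqrt (K * (K - \<mu>)) \<le> sqrt (K * a \<rho> * (K - \<mu>))"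
      using mu by (intro real_sqrt_le_mono mult_right_mono) auto
    ultimately have "c \<le> \<nu> \<rho>" unfolding c_eq \<nu>_def by linarith
    then have "c * lam \<le> \<nu> \<rho> * lam" using lam by simp
    moreover have "0 < \<mu> * lam * (2 - \<nu> \<rho> * lam)"
      using rho(1) by (simp only: eq[symmetric])
    then have "0 < 2 - \<nu> \<rho> * lam"
      by (rule zero_less_mult_pos) (use lam mu in simp)
    ultimately have "c * lam < 2" by linarith
    with lam c_pos show ?r by (simp add: field_simps)
  next
    assume ?r
    then have lam: "0 < lam" and lam_less: "c * lam < 2"
      using c_pos by (auto simp: field_simps)
    define \<psi> where "\<psi> \<rho> = \<mu> * lam * (2 - \<nu> \<rho> * lam) - \<rho>" for \<rho>
    \<comment> \<open>The right end \<open>\<rho>1\<close> of the interval is such that \<open>a \<rho>1 = A\<close>, which is large enough for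
      \<open>\<nu> \<rho>1 * lam \<ge> K * A * lam > 2\<close>.\<close>
    define A where "A = 1 + 2 / (lam * K)"
    have A1: "A > 1" using lam K_pos by (simp add: A_def)
    define \<rho>1 where "\<rho>1 = p i0 * (1 - 1 / A)"
    have rho1: "0 < \<rho>1" "\<rho>1 < p i0"
      using A1 p_pos by (simp_all add: \<rho>1_def)
    have "p i0 - \<rho>1 = p i0 / A" using A1 by (simp add: \<rho>1_def algebra_simps)
    then have a1: "a \<rho>1 = A" using A1 p_pos by (simp add: a_def)
    have "0 \<le> sqrt (K * a \<rho>1 * (K - \<mu>))"
      using K_pos A1 mu by (simp add: a1)
    then have "K * A \<le> \<nu> \<rho>1" using K_pos by (simp add: \<nu>_def a1)
    then have "K * A * lam \<le> \<nu> \<rho>1 * lam" using lam by simp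
    moreover have "K * A * lam = K * lam + 2"
      using lam K_pos by (simp add: A_def field_simps)
    moreover have "0 < K * lam" using lam K_pos by simp
    ultimately have "2 - \<nu> \<rho>1 * lam \<le> 0" by linarith
    then have "\<mu> * lam * (2 - \<nu> \<rho>1 * lam) \<le> 0"
      using lam mu by (intro mult_nonneg_nonpos) auto
    then have end1: "\<psi> \<rho>1 \<le> 0" using rho1 by (simp add: \<psi>_def)
    have "\<nu> 0 = c" using p_pos by (simp add: \<nu>_def a_def c_eq)
    then have end0: "0 < \<psi> 0" using lam mu lam_less by (simp add: \<psi>_def)
    have "continuous_on {0..\<rho>1} \<psi>"
      unfolding \<psi>_def \<nu>_def a_def using rho1
      by (intro continuous_intros) auto
    then obtain \<rho> where r: "0 \<le> \<rho>" "\<rho> \<le> \<rho>1" "\<psi> \<rho> = 0"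
      using IVT2'[of \<psi> \<rho>1 0 0] end0 end1 rho1 by auto
    with end0 have "0 < \<rho>" by (cases "\<rho> = 0") auto
    with r rho1 lam show ?l
      unfolding min_p by (auto simp: nu \<psi>_def intro!: exI[of _ \<rho>])
  qed
  have "max_step_size n Li \<mu> p p = (SUP lam\<in>{lam. 0 < lam \<and> lam < 2 / c}. ereal lam)"
    unfolding max_step_size_def admissible ..
  also have "\<dots> = ereal (2 / c)"
  proof (rule SUP_eqI)
    fix y assume y: "\<And>lam. lam \<in> {lam. 0 < lam \<and> lam < 2 / c} \<Longrightarrow> ereal lam \<le> y"
    show "ereal (2 / c) \<le> y"
    proof (rule dense_le_bounded[of 0])
      show "0 < ereal (2 / c)" using c_pos by simp
      fix w assume "0 < w" "w < ereal (2 / c)"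
      then show "w \<le> y" using y by (cases w) auto
    qed
  qed auto
  finally show ?thesis by (simp add: c_def)
qed

text \<open>With \<open>c = C K\<close> and \<open>m = \<mu> / p i0\<close> the recommended step-size is the reciprocal of the larger root \<open>t\<close> of
\<open>2 t\<^sup>2 - 2 (c + m) t + c m = 0\<close>, which is the equation \<open>t = c/2 (1 + t / (t - m))\<close> with the denominator cleared.\<close>

lemma recommended_step_size_balances:
  fixes c m :: real
  assumes c: "0 < c" and m: "0 < m"
  defines "lam \<equiv> 2 / (c + m + sqrt (c\<^sup>2 + m\<^sup>2))"
  shows "0 < lam" "m * lam < 1" "lam * (c / 2 * (1 + 1 / (1 - m * lam))) = 1"
proof -
  define r where "r = sqrt (c\<^sup>2 + m\<^sup>2)"
  define t where "t = (c + m + r) / 2"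
  have "m \<le> r" unfolding r_def using c m by (intro real_le_rsqrt) auto
  then have t_gt: "m < t" using c by (simp add: t_def)
  have lam: "lam = 1 / t" by (simp add: lam_def t_def r_def)
  show "0 < lam" "m * lam < 1"
    using t_gt m by (simp_all add: lam)
  have "(2 * t - c - m)\<^sup>2 = c\<^sup>2 + m\<^sup>2"
  proof -
    have "2 * t - c - m = r" unfolding t_def by (simp add: field_simps)
    then show ?thesis by (simp add: r_def)
  qed
  then have quad: "c * (2 * t - m) = 2 * t * (t - m)"
    by (simp add: power2_eq_square algebra_simps)
  have "1 - m * lam = (t - m) / t" using t_gt m by (simp add: lam field_simps)
  then have "lam * (c / 2 * (1 + 1 / (1 - m * lam))) = (c * (2 * t - m)) / (2 * t * (t - m))"
    using t_gt m by (simp add: lam divide_simps)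
  also have "\<dots> = 1" using t_gt m by (simp add: quad)
  finally show "lam * (c / 2 * (1 + 1 / (1 - m * lam))) = 1" .
qed

text \<open>The bound \<open>\<mu> \<le> K\<close> holds since \<open>\<mu> \<le> L\<close>, and \<open>L\<close> is at most the mean of the \<open>L\<^sub>i\<close>, which is the average of
the ratios \<open>L\<^sub>i / (n p\<^sub>i)\<close> with weights \<open>p\<^sub>i\<close>.\<close>

lemma saga_step_sizes:
  fixes f :: "nat \<Rightarrow> 'a::euclidean_space \<Rightarrow> real"
  assumes problem: "problem_properties n g f Li L \<mu>" and I: "iid_sampling M n p I"
    and xs: "is_solution n g f xs"
    and i0: "i0 \<in> {1..n}" and K: "K = Li i0 / (real n * p i0)"
    and K_max: "\<And>i. i \<in> {1..n} \<Longrightarrow> Li i / (real n * p i) \<le> K"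
    and p_min: "\<And>i. i \<in> {1..n} \<Longrightarrow> p i0 \<le> p i"
  defines "C \<equiv> 2 + 2 * sqrt (1 - \<mu> / K)"
  defines "lam \<equiv> 2 / (C * K + inverse (p i0) * \<mu> + sqrt ((C * K)\<^sup>2 + (inverse (p i0) * \<mu>)\<^sup>2))"
  shows "max_step_size n Li \<mu> p p = ereal (2 / (C * K))"
    and "(\<lambda>k. integral\<^sup>L M (\<lambda>\<omega>. (norm (saga_x n g f p lam x0 y0 I k \<omega> - xs))\<^sup>2))
      \<in> O(\<lambda>k. (1 - \<mu> * lam) ^ k)"
proof -
  have p_pos: "0 < p i" if "i \<in> {1..n}" for i
    using I that by (simp add: iid_sampling_def)
  have n_pos: "0 < real n" using i0 by auto
  have Li_le: "Li i \<le> real n * p i * K" if "i \<in> {1..n}" for i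
    using K_max[OF that] p_pos[OF that] n_pos by (simp add: pos_divide_le_eq mult.commute)
  have mu: "0 < \<mu>" "\<mu> \<le> K"
  proof -
    show "0 < \<mu>" using problem by (simp add: problem_properties_def strongly_convex_def)
    have "\<mu> \<le> L"
      using problem unfolding problem_properties_def
      by (blast intro: strong_convexity_le_smoothness)
    also have "\<dots> \<le> 1 / real n * (\<Sum>i=1..n. Li i)"
      using problem by (simp add: problem_properties_def)
    also have "\<dots> \<le> 1 / real n * (\<Sum>i=1..n. real n * p i * K)"
      using n_pos by (intro mult_left_mono sum_mono Li_le) auto
    also have "\<dots> = (\<Sum>i=1..n. p i) * K"
      using n_pos by (simp add: sum_distrib_left sum_distrib_right)
    also have "\<dots> = K" by (simp only: iid_sampling_sum_eq_1[OF I] mult_1)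
    finally show "\<mu> \<le> K" .
  qed
  show "max_step_size n Li \<mu> p p = ereal (2 / (C * K))"
    unfolding C_def by (rule max_step_size_closed_form[of i0 n K Li p \<mu>, OF i0 K K_max p_min mu p_pos[OF i0]])
  define s where "s = sqrt (1 - \<mu> / K)"
  have s: "0 \<le> s" "K * s\<^sup>2 = K - \<mu>"
    using mu by (simp_all add: s_def field_simps)
  have CK: "C * K = 2 * (K * (1 + s))" by (simp add: C_def s_def algebra_simps)
  define m where "m = inverse (p i0) * \<mu>"
  have m: "0 < m" "m * lam = \<mu> * lam / p i0"
    using p_pos[OF i0] mu by (simp_all add: m_def field_simps)
  have "0 < C * K" using mu s by (simp add: CK)
  note bal = recommended_step_size_balances[OF this m(1), folded lam_def[folded m_def]]
  have ratio: "p i0 / (p i0 - \<mu> * lam) = 1 / (1 - m * lam)"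
  proof -
    have "p i0 - \<mu> * lam = p i0 * (1 - m * lam)"
      using p_pos[OF i0] by (simp add: m(2) right_diff_distrib)
    then show ?thesis using p_pos[OF i0] by simp
  qed
  interpret contractive_saga n g f Li p L \<mu> lam K s "p i0" xs
  proof
    show "\<mu> * lam < p i0"
      using bal(2) p_pos[OF i0] by (simp add: m(2))
    show "lam * (K * (1 + s) * (1 + p i0 / (p i0 - \<mu> * lam))) \<le> 1"
      using bal(3) by (simp add: ratio CK)
  qed (use problem p_pos p_min Li_le s bal(1) xs iid_sampling_sum_eq_1[OF I] in auto)
  show "(\<lambda>k. integral\<^sup>L M (\<lambda>\<omega>. (norm (saga_x n g f p lam x0 y0 I k \<omega> - xs))\<^sup>2))
      \<in> O(\<lambda>k. (1 - \<mu> * lam) ^ k)"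
    by (rule saga_linear_convergence[OF I])
qed

theorem corollary5p1:
  fixes g :: "real ^ 'N \<Rightarrow> ereal" and f :: "nat \<Rightarrow> real ^ 'N \<Rightarrow> real"
    and n :: nat and Li p :: "nat \<Rightarrow> real" and L \<mu> :: real
    and M :: "'w measure" and I :: "nat \<Rightarrow> 'w \<Rightarrow> nat"
    and x0 :: "real ^ 'N" and y0 :: "nat \<Rightarrow> real ^ 'N"
  assumes "problem_properties n g f Li L \<mu>"
    and "iid_sampling M n p I"
  shows
    "let L_max = (MAX i\<in>{1..n}. Li i);
         L_bar = 1 / real n * (\<Sum>i=1..n. Li i);
         p_min = (MIN i\<in>{1..n}. p i);
         C_U = 2 + 2 * sqrt (1 - \<mu> / L_max);
         C_L = 2 + 2 * sqrt (1 - \<mu> / L_bar);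
         lam_U = 2 / (C_U * L_max + real n * \<mu> + sqrt ((C_U * L_max)\<^sup>2 + (real n * \<mu>)\<^sup>2));
         lam_L = 2 / (C_L * L_bar + inverse p_min * \<mu>
                   + sqrt ((C_L * L_bar)\<^sup>2 + (inverse p_min * \<mu>)\<^sup>2))
     in \<exists>x_star. (\<forall>x. is_solution n g f x \<longleftrightarrow> x = x_star) \<and>
        ((\<forall>i\<in>{1..n}. p i = 1 / real n) \<longrightarrow>
           max_step_size n Li \<mu> p p = ereal (2 / (C_U * L_max)) \<and>
           (\<lambda>k. prob_space.expectation M
                 (\<lambda>\<omega>. (norm (saga_x n g f p lam_U x0 y0 I k \<omega> - x_star))\<^sup>2))
             \<in> O(\<lambda>k. (1 - \<mu> * lam_U) ^ k)) \<and>
        ((\<forall>i\<in>{1..n}. p i = Li i / (\<Sum>j=1..n. Li j)) \<longrightarrow>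
           max_step_size n Li \<mu> p p = ereal (2 / (C_L * L_bar)) \<and>
           (\<lambda>k. prob_space.expectation M
                 (\<lambda>\<omega>. (norm (saga_x n g f p lam_L x0 y0 I k \<omega> - x_star))\<^sup>2))
             \<in> O(\<lambda>k. (1 - \<mu> * lam_L) ^ k))"
proof -
  let ?A = "{1..n}"
  obtain x_star where sol: "\<And>x. is_solution n g f x \<longleftrightarrow> x = x_star"
    using ex1_solution[OF assms(1)] by blast
  then have xs: "is_solution n g f x_star" by blast
  note rates = saga_step_sizes[OF assms xs]
  have n: "0 < n" and Li_pos: "\<And>i. i \<in> ?A \<Longrightarrow> 0 < Li i"
    using assms(1) by (auto simp: problem_properties_def smooth_def)
  have fin: "finite ?A" and ne: "?A \<noteq> {}" using n by auto
  show ?thesis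
    unfolding Let_def
  proof (intro exI[of _ x_star] conjI impI allI)
    show "is_solution n g f x \<longleftrightarrow> x = x_star" for x by (rule sol)
  next
    assume p: "\<forall>i\<in>?A. p i = 1 / real n"
    have "(MAX i\<in>?A. Li i) \<in> Li ` ?A" using fin ne by (intro Max_in) auto
    then obtain i0 where i0: "i0 \<in> ?A" and max: "(MAX i\<in>?A. Li i) = Li i0" by auto
    have K: "(MAX i\<in>?A. Li i) = Li i0 / (real n * p i0)"
      using p i0 n max by simp
    have K_max: "Li i / (real n * p i) \<le> (MAX i\<in>?A. Li i)" if "i \<in> ?A" for i
      using p that n fin by simp
    have p_min: "p i0 \<le> p i" if "i \<in> ?A" for i
      using p i0 that by simp
    have inv: "inverse (p i0) = real n" using p i0 by simp
    note rates[where ?i0.0 = i0 and K = "MAX i\<in>?A. Li i", OF i0 K K_max p_min, unfolded inv]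
    then show "max_step_size n Li \<mu> p p
        = ereal (2 / ((2 + 2 * sqrt (1 - \<mu> / (MAX i\<in>?A. Li i))) * (MAX i\<in>?A. Li i)))"
      and "(\<lambda>k. prob_space.expectation M (\<lambda>\<omega>. (norm (saga_x n g f p
        (2 / ((2 + 2 * sqrt (1 - \<mu> / (MAX i\<in>?A. Li i))) * (MAX i\<in>?A. Li i) + real n * \<mu>
           + sqrt (((2 + 2 * sqrt (1 - \<mu> / (MAX i\<in>?A. Li i))) * (MAX i\<in>?A. Li i))\<^sup>2
                    + (real n * \<mu>)\<^sup>2))) x0 y0 I k \<omega> - x_star))\<^sup>2))
        \<in> O(\<lambda>k. (1 - \<mu> * (2 / ((2 + 2 * sqrt (1 - \<mu> / (MAX i\<in>?A. Li i))) * (MAX i\<in>?A. Li i)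
           + real n * \<mu> + sqrt (((2 + 2 * sqrt (1 - \<mu> / (MAX i\<in>?A. Li i))) * (MAX i\<in>?A. Li i))\<^sup>2
                    + (real n * \<mu>)\<^sup>2)))) ^ k)"
      by - assumption+
  next
    assume p: "\<forall>i\<in>?A. p i = Li i / (\<Sum>j=1..n. Li j)"
    define Lb where "Lb = 1 / real n * (\<Sum>i=1..n. Li i)"
    have sum_pos: "0 < (\<Sum>j=1..n. Li j)" using fin ne Li_pos by (intro sum_pos) auto
    have "(MIN i\<in>?A. p i) \<in> p ` ?A" using fin ne by (intro Min_in) auto
    then obtain i0 where i0: "i0 \<in> ?A" and min: "(MIN i\<in>?A. p i) = p i0" by auto
    have ratio: "Li i / (real n * p i) = Lb" if "i \<in> ?A" for i
      using p that sum_pos Li_pos[OF that] by (simp add: Lb_def)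
    have p_min: "p i0 \<le> p i" if "i \<in> ?A" for i
      using that fin by (simp flip: min)
    note rates = rates[where ?i0.0 = i0 and K = Lb, OF i0 ratio[OF i0, symmetric] eq_refl[OF ratio] p_min]
    show "max_step_size n Li \<mu> p p = ereal (2 / ((2 + 2 * sqrt (1 - \<mu> / Lb)) * Lb))"
      by (rule rates)
    show "(\<lambda>k. prob_space.expectation M (\<lambda>\<omega>. (norm (saga_x n g f p
        (2 / ((2 + 2 * sqrt (1 - \<mu> / Lb)) * Lb + inverse (MIN i\<in>?A. p i) * \<mu>
           + sqrt (((2 + 2 * sqrt (1 - \<mu> / Lb)) * Lb)\<^sup>2 + (inverse (MIN i\<in>?A. p i) * \<mu>)\<^sup>2)))
        x0 y0 I k \<omega> - x_star))\<^sup>2))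
        \<in> O(\<lambda>k. (1 - \<mu> * (2 / ((2 + 2 * sqrt (1 - \<mu> / Lb)) * Lb
           + inverse (MIN i\<in>?A. p i) * \<mu>
           + sqrt (((2 + 2 * sqrt (1 - \<mu> / Lb)) * Lb)\<^sup>2 + (inverse (MIN i\<in>?A. p i) * \<mu>)\<^sup>2)))) ^ k)"
      unfolding min by (rule rates)
  qed
qed

end
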